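(* Let $r,N\ge 1$, let $\lambda=(\lambda_1\ge\dots\ge\lambda_r\ge 0)$ be a partition with $\lambda_1<N$, let $w_1,w_2,w_3,w_4\in S_r$, $\mathbf z\in\mathbb C^r$, and let $s_i\in S_r$ be the simple reflection swapping $i$ and $i+1$. With $\lambda,w_3,w_4$ fixed, write $Z(w_1,w_2;\mathbf z)$ for the partition function of the system $\mathcal S(\lambda,w_1,w_2,w_3,w_4,\mathbf z)$ of the bicolored bosonic model, and let $s_i\mathbf z$ be $\mathbf z$ with $z_i$ and $z_{i+1}$ interchanged. Then the partition function satisfies the four-term recurrence relation $L_i=R_i$, where (with $<$ the Bruhat order) $$L_i=\begin{cases}(1-t)z_i\,Z(w_1,w_2;\mathbf z)+(z_i-z_{i+1})\,Z(w_1,s_iw_2;\mathbf z)&\text{if }s_iw_2<w_2,\\(1-t)z_{i+1}\,Z(w_1,w_2;\mathbf z)+t(z_i-z_{i+1})\,Z(w_1,s_iw_2;\mathbf z)&\text{if }s_iw_2>w_2,\end{cases}$$ $$R_i=\begin{cases}(1-t)z_i\,Z(w_1,w_2;s_i\mathbf z)+(z_i-z_{i+1})\,Z(s_iw_1,w_2;s_i\mathbf z)&\text{if }s_iw_1<w_1,\\(1-t)z_{i+1}\,Z(w_1,w_2;s_i\mathbf z)+t(z_i-z_{i+1})\,Z(s_iw_1,w_2;s_i\mathbf z)&\text{if }s_iw_1>w_1.\end{cases}$$ Together with the characterization of the partition functions of systems with exactly one state and systems with no states, this recurrence completely determines the partition function of any system.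
   Context: Colors are $c_1<\dots<c_r$ and dolors (dual colors) are $d_1<\dots<d_r$; $w_0\in S_r$ is the long element; $t\in\mathbb C$ is a global parameter. Unfused vertices. An unfused vertex carries a color-dolor label $(c,d)$ and a parameter $z\in\mathbb C$. Its left and right (horizontal) edges each carry exactly one element of $\{c_i\}\cup\{d_i\}$; its top and bottom (vertical) edges each carry a number in $\mathbb N=\{0,1,2,\dots\}$ (the number of bosons, i.e. pairs, of type $(c,d)$). The admissible configurations and Boltzmann weights are: (1) left $=$ right $=x$ a dolor, top $=$ bottom $=n$: weight $1$ if $x=d$; if $x\ne d$, weight $z^{\epsilon}t^{\eta}$ with $\epsilon=1$ if $c=c_1$, else $0$, and $\eta=n$ if $x<d$, else $0$. (2) left $=$ right $=a$ a color, top $=$ bottom $=n$: weight $z$ if $a=c$; $t^n$ if $c>a$; $1$ if $c<a$. (3) left $=d$, right $=c$, top $=n\ge1$, bottom $=n-1$: weight $(1-t^n)/(1-t)=1+t+\dots+t^{n-1}$. (4) left $=c$, right $=d$, top $=n$, bottom $=n+1$: weight $(1-t)z$. All other configurations have weight $0$. Fused vertices. Order color-dolor pairs by: $(c,d)<(c',d')$ iff $d>d'$, or $d=d'$ and $c<c'$. A fused vertex with parameter $z$ is a horizontal row of $r^2$ unfused vertices with parameter $z$, one for each pair $(c,d)$, placed left to right in increasing order. A vertical edge of a fused vertex carries an element of $\mathbb N^{r^2}$ (the multiplicity of each pair); its two horizontal edges each carry a color or dolor. A labelling of the four outer edges is admissible if the internal horizontal edges can be labelled so that all the unfused vertices are admissible;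 the weight of the fused vertex is the product of the weights of these unfused vertices. Systems. $\mathcal S(\lambda,w_1,w_2,w_3,w_4,\mathbf z)$ lives on a grid with $r$ rows (numbered $1,\dots,r$ from top to bottom, all vertices of row $i$ having parameter $z_i$) and $N$ columns (numbered $N-1,\dots,0$ from left to right). Boundary conditions: the right boundary edge of row $i$ carries the color $c_{w_1^{-1}(i)}$; the left boundary edge of row $i$ carries the dolor $d_{w_2^{-1}(i)}$; the top boundary carries, for each $i=1,\dots,r$, one boson $(c_{w_3^{-1}(i)},d_{w_4^{-1}w_0(i)})$ in column $\lambda_i$ and nothing else; the bottom boundary is empty. A state is an assignment of spins to all edges compatible with the boundary such that every fused vertex is admissible. The weight of a state is the product of the weights of its fused vertices, and the partition function is the sum of the weights of all states of the system.
   Formalization: "Completely determines" is read as uniqueness: for fixed nonzero t, at z with distinct coordinates, or at all z among solutions continuous in z; for t = 0, only among families jointly continuous in (t,z). Without such conditions uniqueness fails when t = 0 or when z_i = z_{i+1}. *)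

theory Defs
  imports "HOL-Analysis.Analysis" "HOL-Combinatorics.Combinatorics"
begin

section \<open>Unfused vertices\<close>

text \<open>\<open>Color i\<close> is \<open>c\<^sub>i\<close> and \<open>Dolor i\<close> is \<open>d\<^sub>i\<close>, with indices in \<open>{1..r}\<close>.
  A color-dolor pair \<open>(c\<^sub>i, d\<^sub>j)\<close> is encoded by its indices \<open>(i, j)\<close>.\<close>

datatype spin = Color nat | Dolor nat

type_synonym label = "nat \<times> nat"

definition hspins :: "nat \<Rightarrow> spin set" where
  "hspins r = Color ` {1..r} \<union> Dolor ` {1..r}"

definition pairs :: "nat \<Rightarrow> label set" where
  "pairs r = {1..r} \<times> {1..r}"

text \<open>The arguments after the label are the left, top, bottom and right spin.
  Admissibility depends on neither \<open>t\<close> nor \<open>z\<close>; an admissible vertex may have weight zero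
  for special values of the parameters.\<close>

fun unfused_admissible :: "label \<Rightarrow> spin \<Rightarrow> nat \<Rightarrow> nat \<Rightarrow> spin \<Rightarrow> bool" where
  "unfused_admissible (c, d) (Dolor x) n m (Dolor y) \<longleftrightarrow> x = y \<and> m = n"
| "unfused_admissible (c, d) (Color a) n m (Color b) \<longleftrightarrow> a = b \<and> m = n"
| "unfused_admissible (c, d) (Dolor x) n m (Color a) \<longleftrightarrow> x = d \<and> a = c \<and> n \<ge> 1 \<and> m = n - 1"
| "unfused_admissible (c, d) (Color a) n m (Dolor x) \<longleftrightarrow> a = c \<and> x = d \<and> m = n + 1"

text \<open>In the third case of \<open>admissible_weight\<close> the polynomial form of \<open>(1 - t\<^sup>n) / (1 - t)\<close>
  is used, so that the weight has the right value at \<open>t = 1\<close>.\<close>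

fun admissible_weight :: "complex \<Rightarrow> complex \<Rightarrow> label \<Rightarrow> spin \<Rightarrow> nat \<Rightarrow> spin \<Rightarrow> complex" where
  "admissible_weight t z (c, d) (Dolor x) n (Dolor y) =
     (if x = d then 1
      else z ^ (if c = 1 then 1 else 0) * t ^ (if x < d then n else 0))"
| "admissible_weight t z (c, d) (Color a) n (Color b) =
     (if a = c then z else if c > a then t ^ n else 1)"
| "admissible_weight t z (c, d) (Dolor x) n (Color a) = (\<Sum>k<n. t ^ k)"
| "admissible_weight t z (c, d) (Color a) n (Dolor x) = (1 - t) * z"

definition unfused_weight ::
    "complex \<Rightarrow> complex \<Rightarrow> label \<Rightarrow> spin \<Rightarrow> nat \<Rightarrow> nat \<Rightarrow> spin \<Rightarrow> complex" where
  "unfused_weight t z p l n m e =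
     (if unfused_admissible p l n m e then admissible_weight t z p l n e else 0)"


section \<open>Fused vertices\<close>

definition pair_less :: "label \<Rightarrow> label \<Rightarrow> bool" where
  "pair_less p q \<longleftrightarrow> snd p > snd q \<or> (snd p = snd q \<and> fst p < fst q)"

definition pair_list :: "nat \<Rightarrow> label list" where
  "pair_list r = concat (map (\<lambda>d. map (\<lambda>c. (c, d)) [1..<Suc r]) (rev [1..<Suc r]))"

lemma set_pair_list: "set (pair_list r) = pairs r"
  by (force simp: pair_list_def pairs_def simp del: upt_Suc)

lemma sorted_wrt_pair_list: "sorted_wrt pair_less (pair_list r)"
proof -
  have row: "sorted_wrt pair_less (map (\<lambda>c. (c, d)) [1..<Suc r])" for d
    by (simp add: sorted_wrt_map pair_less_def del: upt_Suc)
  have "sorted_wrt pair_less (concat (map (\<lambda>d. map (\<lambda>c. (c, d)) [1..<Suc r]) ds))"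
    if "sorted_wrt (>) ds" for ds
    using that row by (induction ds) (auto simp: sorted_wrt_append pair_less_def simp del: upt_Suc)
  moreover have "sorted_wrt (>) (rev [1..<Suc r])"
    by (simp add: sorted_wrt_rev del: upt_Suc)
  ultimately show ?thesis
    unfolding pair_list_def by blast
qed

lemma length_pair_list: "length (pair_list r) = r\<^sup>2"
  by (simp add: pair_list_def length_concat comp_def sum_list_triv power2_eq_square
      del: upt_Suc)

text \<open>\<open>hs\<close> lists the horizontal spins inside a fused vertex from left to right, including the
  two outer ones \<open>l\<close> and \<open>e\<close>; \<open>tp\<close> and \<open>bt\<close> are the top and bottom multiplicities.\<close>

definition fused_internal ::
    "nat \<Rightarrow> spin \<Rightarrow> (label \<Rightarrow> nat) \<Rightarrow> (label \<Rightarrow> nat) \<Rightarrow> spin \<Rightarrow> spin list \<Rightarrow> bool" where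
  "fused_internal r l tp bt e hs \<longleftrightarrow>
     length hs = r\<^sup>2 + 1 \<and> set hs \<subseteq> hspins r \<and> hs ! 0 = l \<and> hs ! (r\<^sup>2) = e \<and>
     (\<forall>k<r\<^sup>2. let p = pair_list r ! k in
        unfused_admissible p (hs ! k) (tp p) (bt p) (hs ! (k + 1)))"

lemma unfused_admissible_right_unique:
  assumes "unfused_admissible p l n m e" "unfused_admissible p l n m e'"
  shows "e = e'"
  using assms by (cases p; cases l; cases e; cases e') auto

lemma fused_internal_unique:
  assumes a: "fused_internal r l tp bt e hs" and b: "fused_internal r l tp bt e hs'"
  shows "hs = hs'"
proof (rule nth_equalityI)
  show "length hs = length hs'"
    using a b by (simp add: fused_internal_def)
  show "hs ! k = hs' ! k" if "k < length hs" for k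
    using that
  proof (induction k)
    case 0
    then show ?case using a b by (simp add: fused_internal_def)
  next
    case (Suc k)
    then have k: "k < r\<^sup>2" and eq: "hs ! k = hs' ! k"
      using a by (auto simp: fused_internal_def)
    let ?p = "pair_list r ! k"
    have "unfused_admissible ?p (hs ! k) (tp ?p) (bt ?p) (hs ! Suc k)"
      using a k by (simp add: fused_internal_def Let_def)
    moreover have "unfused_admissible ?p (hs ! k) (tp ?p) (bt ?p) (hs' ! Suc k)"
      using b k eq by (simp add: fused_internal_def Let_def)
    ultimately show ?case
      by (rule unfused_admissible_right_unique)
  qed
qed

definition fused_admissible ::
    "nat \<Rightarrow> spin \<Rightarrow> (label \<Rightarrow> nat) \<Rightarrow> (label \<Rightarrow> nat) \<Rightarrow> spin \<Rightarrow> bool" where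
  "fused_admissible r l tp bt e \<longleftrightarrow> (\<exists>hs. fused_internal r l tp bt e hs)"

text \<open>By \<open>fused_internal_unique\<close> the internal spins of an admissible fused vertex are unique.\<close>

definition fused_weight ::
    "complex \<Rightarrow> complex \<Rightarrow> nat \<Rightarrow> spin \<Rightarrow> (label \<Rightarrow> nat) \<Rightarrow> (label \<Rightarrow> nat) \<Rightarrow> spin \<Rightarrow> complex" where
  "fused_weight t z r l tp bt e =
     (if fused_admissible r l tp bt e then
        (let hs = (THE hs. fused_internal r l tp bt e hs) in
           \<Prod>k<r\<^sup>2. let p = pair_list r ! k in
             unfused_weight t z p (hs ! k) (tp p) (bt p) (hs ! (k + 1)))
      else 0)"


section \<open>Systems\<close>

text \<open>Elements of \<open>S\<^sub>r\<close> are functions \<open>w\<close> with \<open>w permutes {1..r}\<close>.\<close>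

definition long_element :: "nat \<Rightarrow> nat \<Rightarrow> nat" where
  "long_element r i = (if i \<in> {1..r} then r + 1 - i else i)"

text \<open>A state is a pair \<open>(h, v)\<close>. Row \<open>i\<close> has the horizontal edges \<open>h (i, j)\<close>, \<open>0 \<le> j \<le> N\<close>, and
  the vertex in column \<open>j\<close> has left edge \<open>h (i, j + 1)\<close> and right edge \<open>h (i, j)\<close> (columns are
  numbered from right to left). The edge above row \<open>i\<close> in column \<open>j\<close> is \<open>v (i - 1, j)\<close> and the
  edge below it is \<open>v (i, j)\<close>. Functions are extensional, so that distinct states differ on an
  actual edge.\<close>

type_synonym state = "(nat \<times> nat \<Rightarrow> spin) \<times> (nat \<times> nat \<Rightarrow> label \<Rightarrow> nat)"

definition states ::
    "nat \<Rightarrow> nat \<Rightarrow> (nat \<Rightarrow> nat) \<Rightarrow> (nat \<Rightarrow> nat) \<Rightarrow> (nat \<Rightarrow> nat) \<Rightarrow> (nat \<Rightarrow> nat) \<Rightarrow> (nat \<Rightarrow> nat) \<Rightarrow>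
     state set" where
  "states r N lam w1 w2 w3 w4 =
     {(h, v).
        h \<in> {1..r} \<times> {0..N} \<rightarrow>\<^sub>E hspins r \<and>
        v \<in> {0..r} \<times> {0..<N} \<rightarrow>\<^sub>E (pairs r \<rightarrow>\<^sub>E UNIV) \<and>
        (\<forall>i\<in>{1..r}. h (i, 0) = Color (inv w1 i)) \<and>
        (\<forall>i\<in>{1..r}. h (i, N) = Dolor (inv w2 i)) \<and>
        (\<forall>j<N. \<forall>p\<in>pairs r. v (0, j) p =
           card {i\<in>{1..r}. lam i = j \<and> (inv w3 i, inv w4 (long_element r i)) = p}) \<and>
        (\<forall>j<N. \<forall>p\<in>pairs r. v (r, j) p = 0) \<and>
        (\<forall>i\<in>{1..r}. \<forall>j<N.
           fused_admissible r (h (i, j + 1)) (v (i - 1, j)) (v (i, j)) (h (i, j)))}"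

definition state_weight ::
    "complex \<Rightarrow> nat \<Rightarrow> nat \<Rightarrow> (nat \<Rightarrow> complex) \<Rightarrow> state \<Rightarrow> complex" where
  "state_weight t r N z s =
     (case s of (h, v) \<Rightarrow>
        \<Prod>i\<in>{1..r}. \<Prod>j<N.
          fused_weight t (z i) r (h (i, j + 1)) (v (i - 1, j)) (v (i, j)) (h (i, j)))"

definition partition_function ::
    "complex \<Rightarrow> nat \<Rightarrow> nat \<Rightarrow> (nat \<Rightarrow> nat) \<Rightarrow> (nat \<Rightarrow> nat) \<Rightarrow> (nat \<Rightarrow> nat) \<Rightarrow>
     (nat \<Rightarrow> nat) \<Rightarrow> (nat \<Rightarrow> nat) \<Rightarrow> (nat \<Rightarrow> complex) \<Rightarrow> complex" where
  "partition_function t r N lam w3 w4 w1 w2 z =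
     (\<Sum>s\<in>states r N lam w1 w2 w3 w4. state_weight t r N z s)"


section \<open>Bruhat order\<close>

definition perm_length :: "nat \<Rightarrow> (nat \<Rightarrow> nat) \<Rightarrow> nat" where
  "perm_length r w = card {(i, j). 1 \<le> i \<and> i < j \<and> j \<le> r \<and> w i > w j}"

definition bruhat_less :: "nat \<Rightarrow> (nat \<Rightarrow> nat) \<Rightarrow> (nat \<Rightarrow> nat) \<Rightarrow> bool" where
  "bruhat_less r u v \<longleftrightarrow>
     (u, v) \<in> {(x, y). x permutes {1..r} \<and>
                 (\<exists>a\<in>{1..r}. \<exists>b\<in>{1..r}. a \<noteq> b \<and> y = Transposition.transpose a b \<circ> x) \<and>
                 perm_length r x < perm_length r y}\<^sup>+"


section \<open>The recurrence\<close>

text \<open>\<open>\<complex>\<^sup>r\<close> is the set of extensional functions on \<open>{1..r}\<close>, with the product topology of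
  functions.\<close>

definition cspace :: "nat \<Rightarrow> (nat \<Rightarrow> complex) set" where
  "cspace r = {1..r} \<rightarrow>\<^sub>E UNIV"

definition simple_refl :: "nat \<Rightarrow> nat \<Rightarrow> nat" where
  "simple_refl i = Transposition.transpose i (i + 1)"

text \<open>A candidate for \<open>Z(w\<^sub>1, w\<^sub>2; z)\<close> has type \<open>family\<close>. In \<open>rec_lhs\<close> and \<open>rec_rhs\<close> the
  \<open>else\<close> branch is the case \<open>s\<^sub>i w > w\<close>, since \<open>s\<^sub>i w\<close> and \<open>w\<close> are always comparable.\<close>

type_synonym family = "(nat \<Rightarrow> nat) \<Rightarrow> (nat \<Rightarrow> nat) \<Rightarrow> (nat \<Rightarrow> complex) \<Rightarrow> complex"

definition rec_lhs ::
    "complex \<Rightarrow> nat \<Rightarrow> family \<Rightarrow> nat \<Rightarrow> (nat \<Rightarrow> nat) \<Rightarrow> (nat \<Rightarrow> nat) \<Rightarrow> (nat \<Rightarrow> complex) \<Rightarrow> complex" where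
  "rec_lhs t r Z i w1 w2 z =
     (if bruhat_less r (simple_refl i \<circ> w2) w2
      then (1 - t) * z i * Z w1 w2 z + (z i - z (i + 1)) * Z w1 (simple_refl i \<circ> w2) z
      else (1 - t) * z (i + 1) * Z w1 w2 z + t * (z i - z (i + 1)) * Z w1 (simple_refl i \<circ> w2) z)"

definition rec_rhs ::
    "complex \<Rightarrow> nat \<Rightarrow> family \<Rightarrow> nat \<Rightarrow> (nat \<Rightarrow> nat) \<Rightarrow> (nat \<Rightarrow> nat) \<Rightarrow> (nat \<Rightarrow> complex) \<Rightarrow> complex" where
  "rec_rhs t r Z i w1 w2 z =
     (let sz = z \<circ> simple_refl i in
      if bruhat_less r (simple_refl i \<circ> w1) w1
      then (1 - t) * z i * Z w1 w2 sz + (z i - z (i + 1)) * Z (simple_refl i \<circ> w1) w2 sz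
      else (1 - t) * z (i + 1) * Z w1 w2 sz + t * (z i - z (i + 1)) * Z (simple_refl i \<circ> w1) w2 sz)"

definition four_term_recurrence :: "complex \<Rightarrow> nat \<Rightarrow> family \<Rightarrow> bool" where
  "four_term_recurrence t r Z \<longleftrightarrow>
     (\<forall>i w1 w2. \<forall>z\<in>cspace r. 1 \<le> i \<and> i < r \<and> w1 permutes {1..r} \<and> w2 permutes {1..r} \<longrightarrow>
        rec_lhs t r Z i w1 w2 z = rec_rhs t r Z i w1 w2 z)"

definition correct_on_small_systems ::
    "complex \<Rightarrow> nat \<Rightarrow> nat \<Rightarrow> (nat \<Rightarrow> nat) \<Rightarrow> (nat \<Rightarrow> nat) \<Rightarrow> (nat \<Rightarrow> nat) \<Rightarrow> family \<Rightarrow> bool" where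
  "correct_on_small_systems t r N lam w3 w4 Z \<longleftrightarrow>
     (\<forall>w1 w2. \<forall>z\<in>cspace r. w1 permutes {1..r} \<and> w2 permutes {1..r} \<longrightarrow>
        (states r N lam w1 w2 w3 w4 = {} \<longrightarrow> Z w1 w2 z = 0) \<and>
        (\<forall>s. states r N lam w1 w2 w3 w4 = {s} \<longrightarrow> Z w1 w2 z = state_weight t r N z s))"

end

theory Submission
  imports Defs
begin

text \<open>The recurrence is the train argument. An R-matrix attached to the left of rows \<open>i\<close> and \<open>i + 1\<close>
  can be moved through all unfused vertices to the right by the Yang--Baxter equation, which
  interchanges the spectral parameters of the two rows. The dolors on the left boundary and the colors
  on the right boundary leave two terms on each side, and these are \<open>L\<^sub>i\<close> and \<open>R\<^sub>i\<close> up to the factor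
  \<open>z\<^sub>i z\<^sub>i\<^sub>+\<^sub>1\<close>, which is cancelled by continuity in \<open>z\<close>.

  For the uniqueness, let \<open>w\<^sub>2\<close> be the permutation for which the dolors enter in the order in which
  their bosons are met from the right. Then every system has at most one state, whatever \<open>w\<^sub>1\<close> is.
  For \<open>t \<noteq> 0\<close> and distinct \<open>z\<^sub>i\<close> the recurrence expresses \<open>Z(w\<^sub>1, s\<^sub>i w\<^sub>2; z)\<close> by values at \<open>w\<^sub>2\<close>, so that it
  carries the equality from this \<open>w\<^sub>2\<close> to all permutations. The remaining parameters
  are limits of such ones.\<close>

section \<open>The Yang--Baxter equation\<close>

text \<open>The R-matrix is not constant inside a fused vertex: crossing \<open>(c, d)\<close> turns
  its label into \<open>(Suc c, d)\<close>. Only \<open>R_diag\<close> sees the label, and after all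
  r^2 unfused vertices it has returned to its initial value, so the same R-matrix arrives at every
  column boundary. This is why \<open>L\<^sub>i\<close> and \<open>R\<^sub>i\<close> have
  coefficients of the same shape. In the uniqueness part, \<open>R\<^sub>i\<close> involves
  \<open>s\<^sub>i w\<^sub>1\<close> and the interchanged parameters but a single second
  permutation. The induction on \<open>w\<^sub>2\<close> therefore treats all
  \<open>w\<^sub>1\<close> and \<open>z\<close> together. The coefficient of the new value in
  \<open>L\<^sub>i\<close> is \<open>z\<^sub>i - z\<^sub>i\<^sub>+\<^sub>1\<close> or
  \<open>t\<close> times it. At \<open>t = 0\<close> the second one vanishes for every
  \<open>z\<close>, and continuity in \<open>z\<close> cannot recover the step; there the proof uses
  joint continuity in \<open>t\<close> and \<open>z\<close>.\<close>

text \<open>The R-matrix depends on the position inside a fused vertex; the label \<open>(c, d)\<close> is the pair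
  of the unfused vertex to its right. A pair \<open>\<alpha>, \<beta>\<close> of strands either keeps its spins on the two
  horizontal lines (\<open>R_diag\<close>) or exchanges them (\<open>R_cross\<close>). The weights were found by solving the
  Yang--Baxter equations as a linear system. The factor \<open>x * y\<close> clears denominators: without it
  \<open>R_diag\<close> on distinct spins would be \<open>(1 - t) * x powi k * y powi (1 - k)\<close> with \<open>-1 \<le> k \<le> 2\<close>.\<close>

fun diag_exp :: "label \<Rightarrow> spin \<Rightarrow> spin \<Rightarrow> nat" where
  "diag_exp (c, d) (Color a) (Color b) =
     (if a > b then (if b < c \<and> c \<le> a then 1 else 2) else (if a < c \<and> c \<le> b then 2 else 1))"
| "diag_exp (c, d) (Dolor x) (Dolor y) =
     (let D = (\<lambda>u. u > d \<or> u = d \<and> c > 1) in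
      if x > y then (if D x \<and> \<not> D y then 1 else 2) else (if D y \<and> \<not> D x then 2 else 1))"
| "diag_exp (c, d) (Color a) (Dolor x) = (if x \<noteq> d \<and> 1 < c \<and> c \<le> a then 0 else 1)"
| "diag_exp (c, d) (Dolor x) (Color a) = (if x \<noteq> d \<and> 1 < c \<and> c \<le> a then 3 else 2)"

fun cross_exp :: "spin \<Rightarrow> spin \<Rightarrow> nat" where
  "cross_exp (Color a) (Color b) = (if a > b then 1 else 0)"
| "cross_exp (Dolor x) (Dolor y) = (if x < y then 1 else 0)"
| "cross_exp (Color a) (Dolor x) = 1"
| "cross_exp (Dolor x) (Color a) = 0"

definition R_diag :: "complex \<Rightarrow> complex \<Rightarrow> complex \<Rightarrow> label \<Rightarrow> spin \<Rightarrow> spin \<Rightarrow> complex" where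
  "R_diag t x y q \<alpha> \<beta> =
     (if \<alpha> = \<beta> then x * y * (x - t * y)
      else (1 - t) * x ^ diag_exp q \<alpha> \<beta> * y ^ (3 - diag_exp q \<alpha> \<beta>))"

definition R_cross :: "complex \<Rightarrow> complex \<Rightarrow> complex \<Rightarrow> spin \<Rightarrow> spin \<Rightarrow> complex" where
  "R_cross t x y \<alpha> \<beta> = (if \<alpha> = \<beta> then 0 else x * y * (x - y) * t ^ cross_exp \<alpha> \<beta>)"

text \<open>Two stacked vertices, \<open>x\<close> above \<open>y\<close>, with the edge between
  them summed out. The cutoff \<open>K\<close> keeps the sum finite; a vertex changes a multiplicity
  by at most one, so nothing is lost as long as \<open>n < K\<close>.\<close>

definition double_weight ::
  "complex \<Rightarrow> nat \<Rightarrow> complex \<Rightarrow> complex \<Rightarrow> label \<Rightarrow> spin \<Rightarrow> spin \<Rightarrow> nat \<Rightarrow> nat \<Rightarrow> spin \<Rightarrow> spin \<Rightarrow> complex" where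
  "double_weight t K x y p \<alpha> \<beta> n m \<gamma> \<delta> =
     (\<Sum>k\<le>K. unfused_weight t x p \<alpha> n k \<gamma> * unfused_weight t y p \<beta> k m \<delta>)"

text \<open>The spins around the upper vertex determine the middle multiplicity as \<open>n\<close>,
  \<open>n - 1\<close> or \<open>n + 1\<close>, so the sum has at most one nonzero term.\<close>

lemma double_weight_simps:
  assumes "n < K"
  shows
    "double_weight t K x y (c, d) (Dolor a) \<beta> n m (Dolor b) \<delta> =
       (if a = b then admissible_weight t x (c, d) (Dolor a) n (Dolor a) * unfused_weight t y (c, d) \<beta> n m \<delta> else 0)"
    "double_weight t K x y (c, d) (Color a) \<beta> n m (Color b) \<delta> =
       (if a = b then admissible_weight t x (c, d) (Color a) n (Color a) * unfused_weight t y (c, d) \<beta> n m \<delta> else 0)"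
    "double_weight t K x y (c, d) (Dolor a) \<beta> n m (Color b) \<delta> =
       (if a = d \<and> b = c \<and> n \<ge> 1 then (\<Sum>k<n. t ^ k) * unfused_weight t y (c, d) \<beta> (n - 1) m \<delta> else 0)"
    "double_weight t K x y (c, d) (Color a) \<beta> n m (Dolor b) \<delta> =
       (if a = c \<and> b = d then (1 - t) * x * unfused_weight t y (c, d) \<beta> (n + 1) m \<delta> else 0)"
proof -
  have *: "(\<Sum>k\<le>K. (if P \<and> k = k0 then w else 0) * f k) = (if P then w * f k0 else 0)"
    if "k0 \<le> K" for P k0 w and f :: "nat \<Rightarrow> complex"
  proof -
    have "(\<Sum>k\<le>K. (if P \<and> k = k0 then w else 0) * f k) = (\<Sum>k\<le>K. if k = k0 then (if P then w * f k else 0) else 0)"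
      by (rule sum.cong) auto
    then show ?thesis using that by simp
  qed
  show "double_weight t K x y (c, d) (Dolor a) \<beta> n m (Dolor b) \<delta> =
       (if a = b then admissible_weight t x (c, d) (Dolor a) n (Dolor a) * unfused_weight t y (c, d) \<beta> n m \<delta> else 0)"
    using *[of n "a = b" "admissible_weight t x (c, d) (Dolor a) n (Dolor b)"] assms
    by (simp add: double_weight_def unfused_weight_def[of t x])
  show "double_weight t K x y (c, d) (Color a) \<beta> n m (Color b) \<delta> =
       (if a = b then admissible_weight t x (c, d) (Color a) n (Color a) * unfused_weight t y (c, d) \<beta> n m \<delta> else 0)"
    using *[of n "a = b" "admissible_weight t x (c, d) (Color a) n (Color b)"] assms
    by (simp add: double_weight_def unfused_weight_def[of t x])
  show "double_weight t K x y (c, d) (Dolor a) \<beta> n m (Color b) \<delta> =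
       (if a = d \<and> b = c \<and> n \<ge> 1 then (\<Sum>k<n. t ^ k) * unfused_weight t y (c, d) \<beta> (n - 1) m \<delta> else 0)"
    using *[of "n - 1" "n \<ge> 1" "\<Sum>k<n. t ^ k"] assms
    by (cases "a = d \<and> b = c") (auto cong: if_cong simp: double_weight_def unfused_weight_def[of t x])
  show "double_weight t K x y (c, d) (Color a) \<beta> n m (Dolor b) \<delta> =
       (if a = c \<and> b = d then (1 - t) * x * unfused_weight t y (c, d) \<beta> (n + 1) m \<delta> else 0)"
    using *[of "n + 1" True "(1 - t) * x"] assms
    by (cases "a = c \<and> b = d") (auto cong: if_cong simp: double_weight_def unfused_weight_def[of t x])
qed

text \<open>The position after the vertex \<open>(c, d)\<close> is labelled \<open>(Suc c, d)\<close> even for \<open>c = r\<close>; by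
  \<open>R_diag_next_dolor\<close> below, \<open>(Suc r, Suc d)\<close> stands for \<open>(1, d)\<close>.\<close>

lemma yang_baxter:
  assumes "n < K" "\<alpha> \<in> hspins r" "\<beta> \<in> hspins r" "\<gamma> \<in> hspins r" "\<delta> \<in> hspins r" "1 \<le> c"
  shows "R_diag t x y (c, d) \<alpha> \<beta> * double_weight t K x y (c, d) \<alpha> \<beta> n m \<gamma> \<delta> +
         R_cross t x y \<alpha> \<beta> * double_weight t K x y (c, d) \<beta> \<alpha> n m \<gamma> \<delta> =
         double_weight t K y x (c, d) \<alpha> \<beta> n m \<gamma> \<delta> * R_diag t x y (Suc c, d) \<gamma> \<delta> +
         double_weight t K y x (c, d) \<alpha> \<beta> n m \<delta> \<gamma> * R_cross t x y \<delta> \<gamma>"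
proof -
  \<comment> \<open>Powers of \<open>t\<close> and the weights of absorbing vertices are tied
    together by \<open>pow\<close>. After its use every case is a polynomial identity in
    \<open>t\<close>, \<open>x\<close>, \<open>y\<close> and \<open>g k\<close>.\<close>
  define g where "g m = (\<Sum>k<m. t ^ k)" for m
  have pow: "t ^ m = 1 - (1 - t) * g m" for m
    using one_diff_power_eq[of t m] by (simp add: g_def algebra_simps)
  show ?thesis
  \<comment> \<open>An absorbing vertex needs \<open>n \<ge> 1\<close> and leads to
    \<open>n - 1\<close>; the case split removes the truncated subtraction.\<close>
  proof (cases n)
    case 0
    show ?thesis using assms unfolding 0
      by (cases \<alpha>; cases \<beta>; cases \<gamma>; cases \<delta>)
        (auto simp: hspins_def double_weight_simps unfused_weight_def R_diag_def R_cross_def not_less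
           numeral_2_eq_2 numeral_3_eq_3 split: if_splits; simp add: algebra_simps)+
  next
    case (Suc k)
    show ?thesis using assms unfolding Suc
      by (cases \<alpha>; cases \<beta>; cases \<gamma>; cases \<delta>)
        (auto simp: hspins_def double_weight_simps unfused_weight_def R_diag_def R_cross_def not_less
           numeral_2_eq_2 numeral_3_eq_3 g_def[symmetric] split: if_splits;
         simp add: pow[of k] algebra_simps)+
  qed
qed

section \<open>Moving the R-matrix through whole rows\<close>

text \<open>In contrast to \<open>fused_weight\<close>, all interior spins are summed over, so that
  a row can be cut at any vertex. The first component of a position is later the column number,
  which keeps apart the occurrences of one label in different columns.\<close>

primrec row_weight ::
    "complex \<Rightarrow> complex \<Rightarrow> nat \<Rightarrow> ('a \<times> label) list \<Rightarrow> spin \<Rightarrow>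
     ('a \<times> label \<Rightarrow> nat) \<Rightarrow> ('a \<times> label \<Rightarrow> nat) \<Rightarrow> spin \<Rightarrow> complex" where
  "row_weight t z r [] l U V e = (if l = e then 1 else 0)"
| "row_weight t z r (q # qs) l U V e =
     (\<Sum>l'\<in>hspins r. unfused_weight t z (snd q) l (U q) (V q) l' * row_weight t z r qs l' U V e)"

definition double_row_weight ::
    "complex \<Rightarrow> nat \<Rightarrow> complex \<Rightarrow> complex \<Rightarrow> nat \<Rightarrow> ('a \<times> label) list \<Rightarrow> spin \<Rightarrow> spin \<Rightarrow>
     ('a \<times> label \<Rightarrow> nat) \<Rightarrow> ('a \<times> label \<Rightarrow> nat) \<Rightarrow> spin \<Rightarrow> spin \<Rightarrow> complex" where
  "double_row_weight t K x y r qs \<alpha> \<beta> U W \<gamma> \<delta> =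
     (\<Sum>V\<in>set qs \<rightarrow>\<^sub>E {..K}. row_weight t x r qs \<alpha> U V \<gamma> * row_weight t y r qs \<beta> V W \<delta>)"

lemma finite_hspins [simp]: "finite (hspins r)"
  by (simp add: hspins_def)

lemma row_weight_cong:
  "(\<And>q. q \<in> set qs \<Longrightarrow> U q = U' q) \<Longrightarrow> (\<And>q. q \<in> set qs \<Longrightarrow> V q = V' q) \<Longrightarrow>
   row_weight t z r qs l U V e = row_weight t z r qs l U' V' e"
  by (induction qs arbitrary: l) auto

lemma double_row_weight_Nil:
  "double_row_weight t K x y r [] \<alpha> \<beta> U W \<gamma> \<delta> = (if \<alpha> = \<gamma> \<and> \<beta> = \<delta> then 1 else 0)"
  by (simp add: double_row_weight_def)

text \<open>As \<open>q\<close> does not recur in \<open>qs\<close>, the middle multiplicity at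
  \<open>q\<close> is chosen independently of those on \<open>qs\<close>, and the sum over
  \<open>V\<close> factors.\<close>

lemma double_row_weight_Cons:
  assumes "distinct (q # qs)"
  shows "double_row_weight t K x y r (q # qs) \<alpha> \<beta> U W \<gamma> \<delta> =
    (\<Sum>\<alpha>'\<in>hspins r. \<Sum>\<beta>'\<in>hspins r. double_weight t K x y (snd q) \<alpha> \<beta> (U q) (W q) \<alpha>' \<beta>' *
       double_row_weight t K x y r qs \<alpha>' \<beta>' U W \<gamma> \<delta>)"
proof -
  have q: "q \<notin> set qs" using assms by simp
  let ?P = "set qs \<rightarrow>\<^sub>E {..K}"
  have upd: "row_weight t x r qs a U (g(q := k)) c = row_weight t x r qs a U g c"
            "row_weight t y r qs a (g(q := k)) W c = row_weight t y r qs a g W c" for a c g k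
    using q by (auto intro!: row_weight_cong)
  have "double_row_weight t K x y r (q # qs) \<alpha> \<beta> U W \<gamma> \<delta> =
     (\<Sum>(k, g)\<in>{..K} \<times> ?P. row_weight t x r (q # qs) \<alpha> U (g(q := k)) \<gamma> *
        row_weight t y r (q # qs) \<beta> (g(q := k)) W \<delta>)"
    using inj_combinator[OF q, of "\<lambda>_. {..K}"]
    by (simp add: double_row_weight_def PiE_insert_eq sum.reindex case_prod_unfold del: row_weight.simps)
  also have "\<dots> = (\<Sum>k\<le>K. \<Sum>g\<in>?P. \<Sum>\<alpha>'\<in>hspins r. \<Sum>\<beta>'\<in>hspins r.
      (unfused_weight t x (snd q) \<alpha> (U q) k \<alpha>' * unfused_weight t y (snd q) \<beta> k (W q) \<beta>') *
      (row_weight t x r qs \<alpha>' U g \<gamma> * row_weight t y r qs \<beta>' g W \<delta>))"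
    by (simp add: sum.cartesian_product[symmetric] upd sum_product mult_ac)
  also have "\<dots> = (\<Sum>k\<le>K. \<Sum>\<alpha>'\<in>hspins r. \<Sum>\<beta>'\<in>hspins r. \<Sum>g\<in>?P.
      (unfused_weight t x (snd q) \<alpha> (U q) k \<alpha>' * unfused_weight t y (snd q) \<beta> k (W q) \<beta>') *
      (row_weight t x r qs \<alpha>' U g \<gamma> * row_weight t y r qs \<beta>' g W \<delta>))"
    by (subst sum.swap[of _ "hspins r" ?P], subst sum.swap[of _ "hspins r" ?P]) (rule refl)
  also have "\<dots> = (\<Sum>\<alpha>'\<in>hspins r. \<Sum>\<beta>'\<in>hspins r. \<Sum>k\<le>K. \<Sum>g\<in>?P.
      (unfused_weight t x (snd q) \<alpha> (U q) k \<alpha>' * unfused_weight t y (snd q) \<beta> k (W q) \<beta>') *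
      (row_weight t x r qs \<alpha>' U g \<gamma> * row_weight t y r qs \<beta>' g W \<delta>))"
    by (subst sum.swap[of _ "hspins r" "{..K}"], subst sum.swap[of _ "hspins r" "{..K}"]) (rule refl)
  finally show ?thesis
    by (simp add: double_weight_def double_row_weight_def sum_product)
qed

text \<open>The Yang--Baxter equation for a stretch \<open>qs\<close> of two rows: the R-matrix
  enters with label \<open>p\<close>, leaves with label \<open>p'\<close>, and \<open>x\<close> and
  \<open>y\<close> change places. The bound on \<open>U\<close> keeps the cutoff \<open>K\<close>
  harmless.\<close>

definition exchange ::
    "complex \<Rightarrow> nat \<Rightarrow> complex \<Rightarrow> complex \<Rightarrow> nat \<Rightarrow> label \<Rightarrow> ('a \<times> label) list \<Rightarrow> label \<Rightarrow> bool" where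
  "exchange t K x y r p qs p' \<longleftrightarrow>
     (\<forall>\<alpha>\<in>hspins r. \<forall>\<beta>\<in>hspins r. \<forall>\<gamma>\<in>hspins r. \<forall>\<delta>\<in>hspins r. \<forall>U W. (\<forall>q\<in>set qs. U q < K) \<longrightarrow>
        R_diag t x y p \<alpha> \<beta> * double_row_weight t K x y r qs \<alpha> \<beta> U W \<gamma> \<delta> +
        R_cross t x y \<alpha> \<beta> * double_row_weight t K x y r qs \<beta> \<alpha> U W \<gamma> \<delta> =
        double_row_weight t K y x r qs \<alpha> \<beta> U W \<gamma> \<delta> * R_diag t x y p' \<gamma> \<delta> +
        double_row_weight t K y x r qs \<alpha> \<beta> U W \<delta> \<gamma> * R_cross t x y \<delta> \<gamma>)"

lemma exchangeD:
  assumes "exchange t K x y r p qs p'" "\<alpha> \<in> hspins r" "\<beta> \<in> hspins r" "\<gamma> \<in> hspins r" "\<delta> \<in> hspins r"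
    "\<And>q. q \<in> set qs \<Longrightarrow> U q < K"
  shows "R_diag t x y p \<alpha> \<beta> * double_row_weight t K x y r qs \<alpha> \<beta> U W \<gamma> \<delta> +
        R_cross t x y \<alpha> \<beta> * double_row_weight t K x y r qs \<beta> \<alpha> U W \<gamma> \<delta> =
        double_row_weight t K y x r qs \<alpha> \<beta> U W \<gamma> \<delta> * R_diag t x y p' \<gamma> \<delta> +
        double_row_weight t K y x r qs \<alpha> \<beta> U W \<delta> \<gamma> * R_cross t x y \<delta> \<gamma>"
  using assms unfolding exchange_def by blast

lemma exchange_Nil: "exchange t K x y r p [] p"
  unfolding exchange_def double_row_weight_Nil by (auto simp: R_cross_def)

lemma exchange_Cons:
  assumes IH: "exchange t K x y r (Suc c, d) qs p'" and dist: "distinct (q # qs)"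
    and q: "snd q = (c, d)" "1 \<le> c"
  shows "exchange t K x y r (c, d) (q # qs) p'"
  unfolding exchange_def
proof (intro ballI allI impI)
  fix \<alpha> \<beta> \<gamma> \<delta> and U W :: "'a \<times> label \<Rightarrow> nat"
  assume sp: "\<alpha> \<in> hspins r" "\<beta> \<in> hspins r" "\<gamma> \<in> hspins r" "\<delta> \<in> hspins r"
    and U: "\<forall>q\<in>set (q # qs). U q < K"
  let ?H = "hspins r"
  let ?T = "\<lambda>x y a b g d'. double_weight t K x y (c, d) a b (U q) (W q) g d'"
  let ?D = "\<lambda>x y a b g d'. double_row_weight t K x y r qs a b U W g d'"
  let ?R = "R_diag t x y" and ?X = "R_cross t x y"
  have "?R (c, d) \<alpha> \<beta> * double_row_weight t K x y r (q # qs) \<alpha> \<beta> U W \<gamma> \<delta> +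
        ?X \<alpha> \<beta> * double_row_weight t K x y r (q # qs) \<beta> \<alpha> U W \<gamma> \<delta> =
     (\<Sum>a\<in>?H. \<Sum>b\<in>?H. (?R (c, d) \<alpha> \<beta> * ?T x y \<alpha> \<beta> a b + ?X \<alpha> \<beta> * ?T x y \<beta> \<alpha> a b) * ?D x y a b \<gamma> \<delta>)"
    by (simp add: double_row_weight_Cons[OF dist] q sum_distrib_left sum.distrib distrib_right mult.assoc)
  also have "\<dots> = (\<Sum>a\<in>?H. \<Sum>b\<in>?H. (?T y x \<alpha> \<beta> a b * ?R (Suc c, d) a b + ?T y x \<alpha> \<beta> b a * ?X b a) * ?D x y a b \<gamma> \<delta>)"
    using U sp q by (intro sum.cong refl) (simp add: yang_baxter[where r = r])
  \<comment> \<open>The crossed terms are summed in the opposite order. Renaming the bound variables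
    then turns \<open>R_cross\<close> on \<open>b\<close>, \<open>a\<close> into
    \<open>R_cross\<close> on \<open>a\<close>, \<open>b\<close>, the form in which
    \<open>IH\<close> applies.\<close>
  also have "\<dots> = (\<Sum>a\<in>?H. \<Sum>b\<in>?H. ?T y x \<alpha> \<beta> a b * ?R (Suc c, d) a b * ?D x y a b \<gamma> \<delta>) +
      (\<Sum>b\<in>?H. \<Sum>a\<in>?H. ?T y x \<alpha> \<beta> b a * ?X b a * ?D x y a b \<gamma> \<delta>)"
    by (subst sum.swap) (simp add: sum.distrib distrib_right)
  also have "\<dots> = (\<Sum>a\<in>?H. \<Sum>b\<in>?H. ?T y x \<alpha> \<beta> a b * (?R (Suc c, d) a b * ?D x y a b \<gamma> \<delta> + ?X a b * ?D x y b a \<gamma> \<delta>))"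
    by (simp add: sum.distrib distrib_left mult.assoc)
  also have "\<dots> = (\<Sum>a\<in>?H. \<Sum>b\<in>?H. ?T y x \<alpha> \<beta> a b * (?D y x a b \<gamma> \<delta> * ?R p' \<gamma> \<delta> + ?D y x a b \<delta> \<gamma> * ?X \<delta> \<gamma>))"
    using U sp by (intro sum.cong refl arg_cong2[of _ _ _ _ "(*)"] exchangeD[OF IH]) auto
  also have "\<dots> = double_row_weight t K y x r (q # qs) \<alpha> \<beta> U W \<gamma> \<delta> * ?R p' \<gamma> \<delta> +
      double_row_weight t K y x r (q # qs) \<alpha> \<beta> U W \<delta> \<gamma> * ?X \<delta> \<gamma>"
    by (simp add: double_row_weight_Cons[OF dist] q sum_distrib_right sum.distrib distrib_left mult.assoc)
  finally show "?R (c, d) \<alpha> \<beta> * double_row_weight t K x y r (q # qs) \<alpha> \<beta> U W \<gamma> \<delta> +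
        ?X \<alpha> \<beta> * double_row_weight t K x y r (q # qs) \<beta> \<alpha> U W \<gamma> \<delta> = \<dots>" .
qed

lemma exchange_transfer:
  assumes "exchange t K x y r p qs p'"
    and "\<And>\<alpha> \<beta>. \<alpha> \<in> hspins r \<Longrightarrow> \<beta> \<in> hspins r \<Longrightarrow> R_diag t x y p0 \<alpha> \<beta> = R_diag t x y p \<alpha> \<beta>"
  shows "exchange t K x y r p0 qs p'"
  using assms unfolding exchange_def by simp

text \<open>\<open>diag_exp\<close> depends on \<open>c\<close> through the side of \<open>c\<close>
  on which a color lies, and both \<open>c = Suc r\<close> and \<open>c = 1\<close> leave all colors
  on one side. For dolors, \<open>D u\<close> says that the vertex \<open>(1, u)\<close>, where the
  dolor \<open>u\<close> misses the factor \<open>z\<close>, has been passed; under both labels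
  these are the \<open>u\<close> above \<open>d\<close>.\<close>

lemma R_diag_next_dolor:
  assumes "\<alpha> \<in> hspins r" "\<beta> \<in> hspins r"
  shows "R_diag t x y (Suc r, Suc d) \<alpha> \<beta> = R_diag t x y (1, d) \<alpha> \<beta>"
  using assms unfolding R_diag_def hspins_def by (cases \<alpha>; cases \<beta>) (auto simp: less_Suc_eq_le Let_def)

text \<open>At \<open>(1, 0)\<close> all dolors satisfy the predicate \<open>D\<close> of
  \<open>diag_exp\<close>, at \<open>(1, r)\<close> none does, and only a difference between two
  dolors matters. This closes the cycle of labels.\<close>

lemma R_diag_next_column:
  assumes "\<alpha> \<in> hspins r" "\<beta> \<in> hspins r"
  shows "R_diag t x y (1, 0) \<alpha> \<beta> = R_diag t x y (1, r) \<alpha> \<beta>"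
  using assms unfolding R_diag_def hspins_def by (cases \<alpha>; cases \<beta>) (auto simp: less_Suc_eq_le Let_def)

lemma exchange_colors:
  assumes "exchange t K x y r (Suc r, d) qs p'" "1 \<le> c" "c \<le> Suc r"
    and "distinct (map (\<lambda>c. (j, (c, d))) [c..<Suc r] @ qs)"
  shows "exchange t K x y r (c, d) (map (\<lambda>c. (j, (c, d))) [c..<Suc r] @ qs) p'"
  using assms(3,2,4)
proof (induction c rule: inc_induct)
  case base
  then show ?case using assms(1) by simp
next
  case (step n)
  have "[n..<Suc r] = n # [Suc n..<Suc r]"
    using step.hyps by (simp add: upt_conv_Cons del: upt_Suc)
  then show ?case using step by (auto intro!: exchange_Cons simp del: upt_Suc)
qed

lemma exchange_dolors:
  assumes "exchange t K x y r (1, 0) qs p'"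
    and "distinct (map (Pair j) (concat (map (\<lambda>d. map (\<lambda>c. (c, d)) [1..<Suc r]) (rev [1..<Suc n]))) @ qs)"
  shows "exchange t K x y r (1, n)
    (map (Pair j) (concat (map (\<lambda>d. map (\<lambda>c. (c, d)) [1..<Suc r]) (rev [1..<Suc n]))) @ qs) p'"
  using assms(2)
proof (induction n)
  case 0
  then show ?case using assms(1) by simp
next
  case (Suc n)
  let ?rest = "map (Pair j) (concat (map (\<lambda>d. map (\<lambda>c. (c, d)) [1..<Suc r]) (rev [1..<Suc n]))) @ qs"
  have eq: "map (Pair j) (concat (map (\<lambda>d. map (\<lambda>c. (c, d)) [1..<Suc r]) (rev [1..<Suc (Suc n)]))) @ qs =
     map (\<lambda>c. (j, (c, Suc n))) [1..<Suc r] @ ?rest"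
    by (subst upt_Suc) (simp add: comp_def del: upt_Suc)
  have dist: "distinct (map (\<lambda>c. (j, (c, Suc n))) [1..<Suc r] @ ?rest)"
    using Suc.prems unfolding eq .
  then have "exchange t K x y r (1, n) ?rest p'"
    by (intro Suc.IH) (simp only: distinct_append)
  \<comment> \<open>The block of \<open>Suc n\<close> ends with label \<open>(Suc r, Suc n)\<close>,
    whereas the next block starts with \<open>(1, n)\<close>.\<close>
  then have "exchange t K x y r (Suc r, Suc n) ?rest p'"
    by (rule exchange_transfer) (rule R_diag_next_dolor)
  then show ?case unfolding eq using dist by (intro exchange_colors) simp_all
qed

primrec columns :: "nat \<Rightarrow> nat \<Rightarrow> (nat \<times> label) list" where
  "columns r 0 = []"
| "columns r (Suc N) = map (Pair N) (pair_list r) @ columns r N"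

lemma set_columns: "set (columns r N) = {..<N} \<times> pairs r"
  by (induction N) (auto simp: set_pair_list)

lemma distinct_pair_list: "distinct (pair_list r)"
proof -
  have "distinct xs" if "sorted_wrt pair_less xs" for xs
    using that by (induction xs) (auto simp: pair_less_def)
  then show ?thesis using sorted_wrt_pair_list by blast
qed

lemma distinct_columns: "distinct (columns r N)"
  by (induction N) (auto simp: distinct_pair_list distinct_map inj_on_def set_columns)

lemma exchange_columns: "exchange t K x y r (1, r) (columns r N) (1, r)"
proof (induction N)
  case 0
  show ?case by (simp add: exchange_Nil)
next
  case (Suc N)
  have "exchange t K x y r (1, 0) (columns r N) (1, r)"
    using Suc R_diag_next_column by (rule exchange_transfer)
  then show ?case
    using distinct_columns[of r "Suc N"] unfolding columns.simps pair_list_def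
    by (intro exchange_dolors)
qed

section \<open>The partition function as a sum over vertical spins\<close>

definition row_path ::
    "nat \<Rightarrow> ('a \<times> label) list \<Rightarrow> spin \<Rightarrow> ('a \<times> label \<Rightarrow> nat) \<Rightarrow> ('a \<times> label \<Rightarrow> nat) \<Rightarrow> spin \<Rightarrow>
     spin list \<Rightarrow> bool" where
  "row_path r qs l U V e hs \<longleftrightarrow>
     length hs = length qs + 1 \<and> set hs \<subseteq> hspins r \<and> hs ! 0 = l \<and> hs ! length qs = e \<and>
     (\<forall>k<length qs. unfused_admissible (snd (qs ! k)) (hs ! k) (U (qs ! k)) (V (qs ! k)) (hs ! Suc k))"

lemma row_path_Cons:
  "row_path r (q # qs) l U V e (h # h' # hs) \<longleftrightarrow>
     h = l \<and> l \<in> hspins r \<and> unfused_admissible (snd q) l (U q) (V q) h' \<and> row_path r qs h' U V e (h' # hs)"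
  by (auto simp: row_path_def All_less_Suc2)

text \<open>The left spin and the vertical spins of a vertex determine its right spin, so a single
  path contributes to the sum.\<close>

lemma row_weight_row_path:
  assumes "row_path r qs l U V e hs"
  shows "row_weight t z r qs l U V e =
    (\<Prod>k<length qs. unfused_weight t z (snd (qs ! k)) (hs ! k) (U (qs ! k)) (V (qs ! k)) (hs ! Suc k))"
  using assms
proof (induction qs arbitrary: l hs)
  case Nil
  then show ?case by (auto simp: row_path_def)
next
  case (Cons q qs)
  then obtain h h' hs' where hs: "hs = h # h' # hs'"
    by (auto simp: row_path_def length_Suc_conv)
  note p = Cons.prems[unfolded hs row_path_Cons]
  have h': "h' \<in> hspins r"
    using p by (simp add: row_path_def)
  have "row_weight t z r (q # qs) l U V e =
      (\<Sum>a\<in>hspins r. if a = h' then unfused_weight t z (snd q) l (U q) (V q) h' * row_weight t z r qs h' U V e else 0)"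
    using p unfused_admissible_right_unique unfolding row_weight.simps
    by (intro sum.cong) (auto simp: unfused_weight_def)
  also have "\<dots> = unfused_weight t z (snd q) l (U q) (V q) h' * row_weight t z r qs h' U V e"
    using h' by simp
  also have "row_weight t z r qs h' U V e = (\<Prod>k<length qs. unfused_weight t z (snd (qs ! k))
      ((h' # hs') ! k) (U (qs ! k)) (V (qs ! k)) ((h' # hs') ! Suc k))"
    using p by (intro Cons.IH) simp
  finally show ?case
    using p unfolding hs by (simp add: prod.lessThan_Suc_shift del: prod.lessThan_Suc)
qed

lemma row_path_if_row_weight:
  assumes "row_weight t z r qs l U V e \<noteq> 0" "l \<in> hspins r"
  shows "\<exists>hs. row_path r qs l U V e hs"
  using assms
proof (induction qs arbitrary: l)
  case Nil
  then show ?case by (intro exI[of _ "[l]"]) (auto simp: row_path_def split: if_splits)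
next
  case (Cons q qs)
  obtain h where h: "h \<in> hspins r" "unfused_weight t z (snd q) l (U q) (V q) h * row_weight t z r qs h U V e \<noteq> 0"
    using Cons.prems(1) unfolding row_weight.simps by (rule sum.not_neutral_contains_not_neutral)
  then obtain hs where hs: "row_path r qs h U V e hs"
    using Cons.IH by auto
  then obtain hs' where "hs = h # hs'"
    by (cases hs) (auto simp: row_path_def)
  then have "row_path r (q # qs) l U V e (l # hs)"
    using hs h Cons.prems(2) by (auto simp: row_path_Cons unfused_weight_def split: if_splits)
  then show ?case ..
qed

lemma fused_internal_iff_row_path:
  assumes "\<And>p. p \<in> pairs r \<Longrightarrow> tp p = U (j, p)" "\<And>p. p \<in> pairs r \<Longrightarrow> bt p = V (j, p)"
  shows "fused_internal r l tp bt e hs \<longleftrightarrow> row_path r (map (Pair j) (pair_list r)) l U V e hs"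
proof -
  have "pair_list r ! k \<in> pairs r" if "k < r\<^sup>2" for k
    using that by (metis length_pair_list nth_mem set_pair_list)
  then show ?thesis
    using assms by (auto simp: fused_internal_def row_path_def length_pair_list Let_def)
qed

text \<open>Replaces the definite description in \<open>fused_weight\<close> by a sum over paths, to
  which the exchange relation applies.\<close>

lemma fused_weight_eq_row_weight:
  assumes tb: "\<And>p. p \<in> pairs r \<Longrightarrow> tp p = U (j, p)" "\<And>p. p \<in> pairs r \<Longrightarrow> bt p = V (j, p)"
    and l: "l \<in> hspins r"
  shows "fused_weight t z r l tp bt e = row_weight t z r (map (Pair j) (pair_list r)) l U V e"
proof -
  have iff: "fused_internal r l tp bt e hs \<longleftrightarrow> row_path r (map (Pair j) (pair_list r)) l U V e hs" for hs
    using tb by (rule fused_internal_iff_row_path)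
  show ?thesis
  proof (cases "fused_admissible r l tp bt e")
  case True
  then obtain hs where hs: "fused_internal r l tp bt e hs"
    by (auto simp: fused_admissible_def)
  then have the: "(THE hs. fused_internal r l tp bt e hs) = hs"
    using fused_internal_unique by blast
  have "pair_list r ! k \<in> pairs r" if "k < r\<^sup>2" for k
    using that by (metis length_pair_list nth_mem set_pair_list)
  then show ?thesis
    using True hs tb row_weight_row_path[OF hs[unfolded iff], of t z] unfolding fused_weight_def the
    by (simp add: length_pair_list Let_def)
next
  case False
  then have "row_weight t z r (map (Pair j) (pair_list r)) l U V e = 0"
    using row_path_if_row_weight[OF _ l] iff unfolding fused_admissible_def by blast
  then show ?thesis using False by (simp add: fused_weight_def)
  qed
qed

lemma row_weight_append:
  assumes "l \<in> hspins r"
  shows "row_weight t z r (ps @ qs) l U V e =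
    (\<Sum>m\<in>hspins r. row_weight t z r ps l U V m * row_weight t z r qs m U V e)"
  using assms
proof (induction ps arbitrary: l)
  case Nil
  have "(\<Sum>m\<in>hspins r. row_weight t z r [] l U V m * row_weight t z r qs m U V e) =
      (\<Sum>m\<in>hspins r. if l = m then row_weight t z r qs l U V e else 0)"
    by (intro sum.cong) auto
  then show ?case using Nil by simp
next
  case (Cons p ps)
  have "(\<Sum>m\<in>hspins r. row_weight t z r (p # ps) l U V m * row_weight t z r qs m U V e) =
      (\<Sum>m\<in>hspins r. \<Sum>l'\<in>hspins r. unfused_weight t z (snd p) l (U p) (V p) l' *
         (row_weight t z r ps l' U V m * row_weight t z r qs m U V e))"
    by (simp add: sum_distrib_right mult.assoc)
  also have "\<dots> = row_weight t z r ((p # ps) @ qs) l U V e"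
    by (subst sum.swap) (simp add: sum_distrib_left[symmetric] Cons.IH)
  finally show ?case ..
qed

definition row_spins :: "nat \<Rightarrow> nat \<Rightarrow> spin \<Rightarrow> spin \<Rightarrow> (nat \<Rightarrow> spin) set" where
  "row_spins r N l e = {g \<in> {0..N} \<rightarrow>\<^sub>E hspins r. g 0 = e \<and> g N = l}"

lemma finite_row_spins [simp]: "finite (row_spins r N l e)"
  unfolding row_spins_def by (rule finite_subset[of _ "{0..N} \<rightarrow>\<^sub>E hspins r"]) (auto intro!: finite_PiE)

text \<open>Induction on the number of columns. The leftmost column has the largest number, and the
  spin \<open>m\<close> on its right edge is the left boundary of the remaining row.\<close>

lemma sum_row_spins:
  assumes "l \<in> hspins r"
    and UV: "\<And>j p. j < N \<Longrightarrow> p \<in> pairs r \<Longrightarrow> u j p = U (j, p)" "\<And>j p. j < N \<Longrightarrow> p \<in> pairs r \<Longrightarrow> v j p = V (j, p)"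
  shows "(\<Sum>g\<in>row_spins r N l e. \<Prod>j<N. fused_weight t z r (g (j + 1)) (u j) (v j) (g j)) =
    row_weight t z r (columns r N) l U V e"
  using assms
proof (induction N arbitrary: l)
  case 0
  have "row_spins r 0 l e = (if l = e then {(\<lambda>_. undefined)(0 := l)} else {})"
    using 0 by (auto simp: row_spins_def PiE_def extensional_def fun_eq_iff)
  then show ?case by simp
next
  case (Suc N)
  let ?f = "\<lambda>g j. fused_weight t z r (g (j + 1)) (u j) (v j) (g j)"
  have "row_weight t z r (columns r (Suc N)) l U V e =
      (\<Sum>m\<in>hspins r. fused_weight t z r l (u N) (v N) m * row_weight t z r (columns r N) m U V e)"
    using Suc.prems by (simp add: row_weight_append fused_weight_eq_row_weight[of r "u N" U N "v N" V])
  also have "\<dots> = (\<Sum>m\<in>hspins r. \<Sum>g\<in>row_spins r N m e. fused_weight t z r l (u N) (v N) m * (\<Prod>j<N. ?f g j))"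
    using Suc by (simp add: sum_distrib_left[symmetric])
  also have "\<dots> = (\<Sum>(m, g)\<in>Sigma (hspins r) (\<lambda>m. row_spins r N m e).
      fused_weight t z r l (u N) (v N) m * (\<Prod>j<N. ?f g j))"
    by (rule sum.Sigma) auto
  also have "\<dots> = (\<Sum>g\<in>row_spins r (Suc N) l e. \<Prod>j<Suc N. ?f g j)"
  proof (rule sum.reindex_bij_witness[of _ "\<lambda>h. (h N, restrict h {0..N})" "\<lambda>(m, g). g(Suc N := l)"])
    fix a assume a: "a \<in> Sigma (hspins r) (\<lambda>m. row_spins r N m e)"
    obtain m g where mg: "a = (m, g)" by (cases a)
    have g: "g \<in> {0..N} \<rightarrow>\<^sub>E hspins r" "g 0 = e" "g N = m" "m \<in> hspins r"
      using a by (auto simp: mg row_spins_def)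
    have "restrict (g(Suc N := l)) {0..N} = g"
      using g by (auto simp: restrict_def fun_eq_iff PiE_def extensional_def)
    then show "(\<lambda>h. (h N, restrict h {0..N})) ((\<lambda>(m, g). g(Suc N := l)) a) = a"
      using g by (simp add: mg)
    have "g(Suc N := l) \<in> {0..Suc N} \<rightarrow>\<^sub>E hspins r"
      using g(1) Suc.prems(1) by (auto simp: PiE_iff extensional_def)
    then show "(\<lambda>(m, g). g(Suc N := l)) a \<in> row_spins r (Suc N) l e"
      using g by (auto simp: mg row_spins_def)
    show "(\<Prod>j<Suc N. ?f ((\<lambda>(m, g). g(Suc N := l)) a) j) =
        (case a of (m, g) \<Rightarrow> fused_weight t z r l (u N) (v N) m * (\<Prod>j<N. ?f g j))"
      using g by (simp add: mg mult.commute)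
  next
    fix h assume h: "h \<in> row_spins r (Suc N) l e"
    then show "(\<lambda>(m, g). g(Suc N := l)) (h N, restrict h {0..N}) = h"
      by (auto simp: row_spins_def fun_eq_iff PiE_def extensional_def)
    show "(h N, restrict h {0..N}) \<in> Sigma (hspins r) (\<lambda>m. row_spins r N m e)"
      using h by (auto simp: row_spins_def PiE_iff)
  qed
  finally show ?case ..
qed

lemma fused_admissible_bottom_le:
  assumes "fused_admissible r l tp bt e" "p \<in> pairs r"
  shows "bt p \<le> tp p + 1"
proof -
  obtain hs where hs: "fused_internal r l tp bt e hs"
    using assms(1) by (auto simp: fused_admissible_def)
  obtain k where k: "k < r\<^sup>2" "pair_list r ! k = p"
    using assms(2) by (metis in_set_conv_nth length_pair_list set_pair_list)
  then have "unfused_admissible p (hs ! k) (tp p) (bt p) (hs ! (k + 1))"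
    using hs by (auto simp: fused_internal_def Let_def)
  then show ?thesis
    by (cases p; cases "hs ! k"; cases "hs ! (k + 1)") auto
qed

definition horizontal_spins :: "nat \<Rightarrow> nat \<Rightarrow> (nat \<Rightarrow> nat) \<Rightarrow> (nat \<Rightarrow> nat) \<Rightarrow> (nat \<times> nat \<Rightarrow> spin) set" where
  "horizontal_spins r N w1 w2 =
     {h \<in> {1..r} \<times> {0..N} \<rightarrow>\<^sub>E hspins r.
        (\<forall>i\<in>{1..r}. h (i, 0) = Color (inv w1 i)) \<and> (\<forall>i\<in>{1..r}. h (i, N) = Dolor (inv w2 i))}"

text \<open>Row by row a multiplicity grows by at most one, and it starts with at most \<open>r\<close>; this makes
  the sum over vertical spins finite without changing the partition function.\<close>

definition vertical_spins ::
    "nat \<Rightarrow> nat \<Rightarrow> (nat \<Rightarrow> nat) \<Rightarrow> (nat \<Rightarrow> nat) \<Rightarrow> (nat \<Rightarrow> nat) \<Rightarrow> (nat \<times> nat \<Rightarrow> label \<Rightarrow> nat) set" where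
  "vertical_spins r N lam w3 w4 =
     {v \<in> {0..r} \<times> {0..<N} \<rightarrow>\<^sub>E (pairs r \<rightarrow>\<^sub>E UNIV).
        (\<forall>j<N. \<forall>p\<in>pairs r. v (0, j) p =
           card {i\<in>{1..r}. lam i = j \<and> (inv w3 i, inv w4 (long_element r i)) = p}) \<and>
        (\<forall>j<N. \<forall>p\<in>pairs r. v (r, j) p = 0) \<and>
        (\<forall>i\<le>r. \<forall>j<N. \<forall>p\<in>pairs r. v (i, j) p \<le> r + i)}"

lemma finite_horizontal_spins: "finite (horizontal_spins r N w1 w2)"
  unfolding horizontal_spins_def
  by (rule finite_subset[of _ "{1..r} \<times> {0..N} \<rightarrow>\<^sub>E hspins r"]) (auto intro!: finite_PiE)

lemma finite_vertical_spins: "finite (vertical_spins r N lam w3 w4)"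
proof (rule finite_subset)
  show "vertical_spins r N lam w3 w4 \<subseteq> {0..r} \<times> {0..<N} \<rightarrow>\<^sub>E (pairs r \<rightarrow>\<^sub>E {..2 * r})"
  proof
    fix v assume v: "v \<in> vertical_spins r N lam w3 w4"
    have "v (i, j) p \<le> 2 * r" if "i \<le> r" "j < N" "p \<in> pairs r" for i j p
    proof -
      have "v (i, j) p \<le> r + i"
        using v that by (simp add: vertical_spins_def)
      then show ?thesis using that(1) by simp
    qed
    moreover have "v \<in> {0..r} \<times> {0..<N} \<rightarrow>\<^sub>E (pairs r \<rightarrow>\<^sub>E UNIV)"
      using v by (simp add: vertical_spins_def)
    ultimately show "v \<in> {0..r} \<times> {0..<N} \<rightarrow>\<^sub>E (pairs r \<rightarrow>\<^sub>E {..2 * r})"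
      by (simp add: PiE_iff)
  qed
  show "finite ({0..r} \<times> {0..<N} \<rightarrow>\<^sub>E (pairs r \<rightarrow>\<^sub>E {..2 * r}))"
    by (auto intro!: finite_PiE simp: pairs_def)
qed

lemma states_subset:
  "states r N lam w1 w2 w3 w4 \<subseteq> horizontal_spins r N w1 w2 \<times> vertical_spins r N lam w3 w4"
proof clarify
  fix h v assume s: "(h, v) \<in> states r N lam w1 w2 w3 w4"
  have "v (i, j) p \<le> r + i" if "i \<le> r" "j < N" "p \<in> pairs r" for i j p
    using that(1)
  proof (induction i)
    case 0
    have "card {i\<in>{1..r}. lam i = j \<and> (inv w3 i, inv w4 (long_element r i)) = p} \<le> card {1..r}"
      by (intro card_mono) auto
    then show ?case using s that by (simp add: states_def)
  next
    case (Suc i)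
    have "\<forall>i\<in>{1..r}. \<forall>j<N. fused_admissible r (h (i, j + 1)) (v (i - 1, j)) (v (i, j)) (h (i, j))"
      using s by (simp add: states_def)
    then have "fused_admissible r (h (Suc i, j + 1)) (v (i, j)) (v (Suc i, j)) (h (Suc i, j))"
      using Suc.prems that(2) by (metis One_nat_def Suc_le_mono atLeastAtMost_iff diff_Suc_1 le0)
    from fused_admissible_bottom_le[OF this that(3)] Suc show ?case by simp
  qed
  then show "h \<in> horizontal_spins r N w1 w2 \<and> v \<in> vertical_spins r N lam w3 w4"
    using s by (simp add: states_def horizontal_spins_def vertical_spins_def)
qed

definition boson_row :: "(nat \<times> nat \<Rightarrow> label \<Rightarrow> nat) \<Rightarrow> nat \<Rightarrow> nat \<times> label \<Rightarrow> nat" where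
  "boson_row v i = (\<lambda>(j, p). v (i, j) p)"

lemma inv_permutes_mem:
  assumes "w permutes {1..r}" "i \<in> {1..r}"
  shows "inv w i \<in> {1..r}"
  using assms by (meson permutes_in_image permutes_inv)

text \<open>Once the vertical spins are fixed, the rows no longer interact, and the sum over
  horizontal spins becomes a product over rows.\<close>

lemma partition_function_eq_sum_rows:
  assumes w: "w1 permutes {1..r}" "w2 permutes {1..r}"
  shows "partition_function t r N lam w3 w4 w1 w2 z =
    (\<Sum>v\<in>vertical_spins r N lam w3 w4. \<Prod>i\<in>{1..r}.
       row_weight t (z i) r (columns r N) (Dolor (inv w2 i)) (boson_row v (i - 1)) (boson_row v i) (Color (inv w1 i)))"
    (is "_ = (\<Sum>v\<in>?V. \<Prod>i\<in>{1..r}. ?W v i)")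
proof -
  let ?H = "horizontal_spins r N w1 w2"
  let ?f = "\<lambda>v i g. \<Prod>j<N. fused_weight t (z i) r (g (j + 1)) (v (i - 1, j)) (v (i, j)) (g j)"
  let ?A = "\<lambda>i. row_spins r N (Dolor (inv w2 i)) (Color (inv w1 i))"
  let ?curry = "\<lambda>h. \<lambda>i\<in>{1..r}. \<lambda>j\<in>{0..N}. h (i, j)"
  let ?uncurry = "\<lambda>g. restrict (\<lambda>(i, j). g i j) ({1..r} \<times> {0..N})"
  \<comment> \<open>Currying: a horizontal configuration is an independent choice of one word of
    spins for each row.\<close>
  have bij: "bij_betw ?curry ?H (PiE {1..r} ?A)"
  proof (rule bij_betw_byWitness[where f' = ?uncurry])
    show "\<forall>h\<in>?H. ?uncurry (?curry h) = h"
    proof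
      fix h assume "h \<in> ?H"
      then have "h \<in> {1..r} \<times> {0..N} \<rightarrow>\<^sub>E hspins r"
        by (simp add: horizontal_spins_def)
      then have "h x = undefined" if "x \<notin> {1..r} \<times> {0..N}" for x
        using that by (rule PiE_arb)
      then show "?uncurry (?curry h) = h"
        by (intro ext) (auto simp: restrict_def)
    qed
    show "\<forall>g\<in>PiE {1..r} ?A. ?curry (?uncurry g) = g"
    proof
      fix g assume g: "g \<in> PiE {1..r} ?A"
      then have "g i = undefined" if "i \<notin> {1..r}" for i
        using that by (rule PiE_arb)
      moreover have "g i j = undefined" if "i \<in> {1..r}" "j \<notin> {0..N}" for i j
      proof -
        have "g i \<in> {0..N} \<rightarrow>\<^sub>E hspins r"
          using PiE_mem[OF g that(1)] by (simp add: row_spins_def)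
        then show ?thesis using that(2) by (rule PiE_arb)
      qed
      ultimately show "?curry (?uncurry g) = g"
        by (intro ext) (auto simp: restrict_def)
    qed
    show "?curry ` ?H \<subseteq> PiE {1..r} ?A"
      by (auto simp: horizontal_spins_def row_spins_def)
    show "?uncurry ` PiE {1..r} ?A \<subseteq> ?H"
      by (auto simp: horizontal_spins_def row_spins_def PiE_iff)
  qed
  \<comment> \<open>The index set is enlarged to a product. A pair that is not a state has an
    inadmissible fused vertex and so contributes 0.\<close>
  have "partition_function t r N lam w3 w4 w1 w2 z = (\<Sum>s\<in>?H \<times> ?V. state_weight t r N z s)"
    unfolding partition_function_def
  proof (rule sum.mono_neutral_left[OF _ states_subset])
    show "finite (?H \<times> ?V)"
      by (simp add: finite_horizontal_spins finite_vertical_spins)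
    show "\<forall>s\<in>?H \<times> ?V - states r N lam w1 w2 w3 w4. state_weight t r N z s = 0"
    proof clarify
      fix h v assume hv: "h \<in> ?H" "v \<in> ?V" "(h, v) \<notin> states r N lam w1 w2 w3 w4"
      then have "\<not> (\<forall>i\<in>{1..r}. \<forall>j<N. fused_admissible r (h (i, j + 1)) (v (i - 1, j)) (v (i, j)) (h (i, j)))"
        by (simp add: states_def horizontal_spins_def vertical_spins_def)
      then obtain i j where ij: "i \<in> {1..r}" "j < N"
          "\<not> fused_admissible r (h (i, j + 1)) (v (i - 1, j)) (v (i, j)) (h (i, j))"
        by blast
      then have "(\<Prod>j<N. fused_weight t (z i) r (h (i, j + 1)) (v (i - 1, j)) (v (i, j)) (h (i, j))) = 0"
        by (intro prod_zero) (auto simp: fused_weight_def)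
      with ij(1) show "state_weight t r N z (h, v) = 0"
        unfolding state_weight_def by (auto intro!: prod_zero)
    qed
  qed
  also have "\<dots> = (\<Sum>v\<in>?V. \<Sum>h\<in>?H. \<Prod>i\<in>{1..r}. ?f v i (\<lambda>j. h (i, j)))"
    by (subst sum.swap) (simp add: sum.cartesian_product state_weight_def)
  also have "\<dots> = (\<Sum>v\<in>?V. \<Sum>g\<in>PiE {1..r} ?A. \<Prod>i\<in>{1..r}. ?f v i (g i))"
  proof (rule sum.cong[OF refl])
    fix v
    show "(\<Sum>h\<in>?H. \<Prod>i\<in>{1..r}. ?f v i (\<lambda>j. h (i, j))) = (\<Sum>g\<in>PiE {1..r} ?A. \<Prod>i\<in>{1..r}. ?f v i (g i))"
      unfolding sum.reindex_bij_betw[OF bij, symmetric] by (intro sum.cong prod.cong refl) auto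
  qed
  also have "\<dots> = (\<Sum>v\<in>?V. \<Prod>i\<in>{1..r}. \<Sum>g\<in>?A i. ?f v i g)"
    by (intro sum.cong refl prod_sum_PiE[symmetric]) simp_all
  also have "\<dots> = (\<Sum>v\<in>?V. \<Prod>i\<in>{1..r}. ?W v i)"
    using inv_permutes_mem[OF w(2)]
    by (intro sum.cong prod.cong refl sum_row_spins) (auto simp: boson_row_def hspins_def)
  finally show ?thesis .
qed

section \<open>The four-term recurrence\<close>

text \<open>Parameters and boundary spins of rows \<open>i\<close> and \<open>i + 1\<close> are
  arguments of their own, so that all four partition functions in the recurrence are values of this
  one function. The set \<V> is variable because the exchange is done on each fibre
  separately.\<close>

definition adjacent_rows ::
    "complex \<Rightarrow> nat \<Rightarrow> nat \<Rightarrow> (nat \<times> nat \<Rightarrow> label \<Rightarrow> nat) set \<Rightarrow> (nat \<Rightarrow> complex) \<Rightarrow> (nat \<Rightarrow> spin) \<Rightarrow> (nat \<Rightarrow> spin) \<Rightarrow>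
     nat \<Rightarrow> complex \<Rightarrow> complex \<Rightarrow> spin \<Rightarrow> spin \<Rightarrow> spin \<Rightarrow> spin \<Rightarrow> complex" where
  "adjacent_rows t r N \<V> z l e i x y \<alpha> \<beta> \<gamma> \<delta> =
     (\<Sum>v\<in>\<V>. (\<Prod>k\<in>{1..r} - {i, i + 1}.
         row_weight t (z k) r (columns r N) (l k) (boson_row v (k - 1)) (boson_row v k) (e k)) *
       (row_weight t x r (columns r N) \<alpha> (boson_row v (i - 1)) (boson_row v i) \<gamma> *
        row_weight t y r (columns r N) \<beta> (boson_row v i) (boson_row v (i + 1)) \<delta>))"

lemma partition_function_eq_adjacent_rows:
  assumes w: "w1 permutes {1..r}" "w2 permutes {1..r}" and i: "1 \<le> i" "i < r"
    and z: "\<And>k. k \<notin> {i, i + 1} \<Longrightarrow> z k = z' k" "\<And>k. k \<notin> {i, i + 1} \<Longrightarrow> l k = Dolor (inv w2 k)"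
      "\<And>k. k \<notin> {i, i + 1} \<Longrightarrow> e k = Color (inv w1 k)"
  shows "partition_function t r N lam w3 w4 w1 w2 z' =
    adjacent_rows t r N (vertical_spins r N lam w3 w4) z l e i (z' i) (z' (i + 1))
      (Dolor (inv w2 i)) (Dolor (inv w2 (i + 1))) (Color (inv w1 i)) (Color (inv w1 (i + 1)))"
proof -
  have split: "(\<Prod>k\<in>{1..r}. f k) = (\<Prod>k\<in>{1..r} - {i, i + 1}. f k) * (f i * f (i + 1))" for f :: "nat \<Rightarrow> complex"
  proof -
    have "(\<Prod>k\<in>{1..r}. f k) = (\<Prod>k\<in>{1..r} - {i, i + 1}. f k) * (\<Prod>k\<in>{i, i + 1}. f k)"
      using i by (intro prod.subset_diff) auto
    then show ?thesis by simp
  qed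
  show ?thesis
    unfolding partition_function_eq_sum_rows[OF w] adjacent_rows_def split using z
    by (intro sum.cong arg_cong2[of _ _ _ _ "(*)"] prod.cong) auto
qed

text \<open>On such a fibre only the edges between rows \<open>i\<close> and \<open>i + 1\<close>
  vary. The bound \<open>r + i\<close> on them in \<open>vertical_spins\<close> is the cutoff of
  \<open>double_row_weight\<close>, and \<open>1 \<le> i < r\<close> keeps them off the top and
  bottom boundary.\<close>

lemma sum_fibre_eq_double_row_weight:
  assumes v0: "v0 \<in> vertical_spins r N lam w3 w4" and i: "1 \<le> i" "i < r"
  shows "adjacent_rows t r N {v \<in> vertical_spins r N lam w3 w4. \<forall>k j. k \<noteq> i \<longrightarrow> v (k, j) = v0 (k, j)} z l e i x y \<alpha> \<beta> \<gamma> \<delta> =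
    (\<Prod>k\<in>{1..r} - {i, i + 1}.
         row_weight t (z k) r (columns r N) (l k) (boson_row v0 (k - 1)) (boson_row v0 k) (e k)) *
    double_row_weight t (r + i) x y r (columns r N) \<alpha> \<beta> (boson_row v0 (i - 1)) (boson_row v0 (i + 1)) \<gamma> \<delta>"
proof -
  let ?F = "{v \<in> vertical_spins r N lam w3 w4. \<forall>k j. k \<noteq> i \<longrightarrow> v (k, j) = v0 (k, j)}"
  let ?Y = "set (columns r N) \<rightarrow>\<^sub>E {..r + i}"
  \<comment> \<open>\<open>ins\<close> writes \<open>Y\<close> between the two rows of
    \<open>v0\<close>, and \<open>pick\<close> reads it off; they are inverse bijections.\<close>
  define ins where "ins Y = (\<lambda>(k, j). if k = i \<and> j < N then (\<lambda>p\<in>pairs r. Y (j, p)) else v0 (k, j))"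
    for Y :: "nat \<times> label \<Rightarrow> nat"
  define pick where "pick v = restrict (boson_row v i) (set (columns r N))" for v
  have mem: "ins Y \<in> ?F" if Y: "Y \<in> ?Y" for Y
  proof -
    have le: "Y (j, p) \<le> r + i" if "j < N" "p \<in> pairs r" for j p
      using PiE_mem[OF Y, of "(j, p)"] that by (simp add: set_columns)
    have "ins Y \<in> {0..r} \<times> {0..<N} \<rightarrow>\<^sub>E (pairs r \<rightarrow>\<^sub>E UNIV)"
    proof (rule PiE_I)
      fix a assume "a \<in> {0..r} \<times> {0..<N}"
      then show "ins Y a \<in> pairs r \<rightarrow>\<^sub>E UNIV"
        using v0 by (auto simp: ins_def vertical_spins_def PiE_iff)
    next
      fix a assume "a \<notin> {0..r} \<times> {0..<N}"
      then show "ins Y a = undefined"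
        using v0 i by (cases a) (auto simp: ins_def vertical_spins_def PiE_iff extensional_def)
    qed
    then show ?thesis
      using v0 i le by (auto simp: ins_def vertical_spins_def)
  qed
  have pick_ins: "pick (ins Y) = Y" if Y: "Y \<in> ?Y" for Y
  proof (rule extensionalityI[of _ "set (columns r N)"])
    show "pick (ins Y) \<in> extensional (set (columns r N))"
      by (simp add: pick_def)
    show "Y \<in> extensional (set (columns r N))"
      using Y by (simp add: PiE_def)
    show "pick (ins Y) q = Y q" if "q \<in> set (columns r N)" for q
      using that by (auto simp: pick_def ins_def boson_row_def set_columns)
  qed
  have "adjacent_rows t r N ?F z l e i x y \<alpha> \<beta> \<gamma> \<delta> =
    (\<Sum>Y\<in>?Y. (\<Prod>k\<in>{1..r} - {i, i + 1}.
         row_weight t (z k) r (columns r N) (l k) (boson_row v0 (k - 1)) (boson_row v0 k) (e k)) *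
       (row_weight t x r (columns r N) \<alpha> (boson_row v0 (i - 1)) Y \<gamma> *
        row_weight t y r (columns r N) \<beta> Y (boson_row v0 (i + 1)) \<delta>))"
    unfolding adjacent_rows_def
  proof (rule sum.reindex_bij_witness[of _ ins pick])
    fix v assume v: "v \<in> ?F"
    then have "v \<in> {0..r} \<times> {0..<N} \<rightarrow>\<^sub>E (pairs r \<rightarrow>\<^sub>E UNIV)"
      by (simp add: vertical_spins_def)
    then have ext: "v (i, j) \<in> extensional (pairs r)" if "j < N" for j
      using that i by (auto simp: PiE_iff)
    show "ins (pick v) = v"
    proof
      fix a :: "nat \<times> nat"
      obtain k j where a: "a = (k, j)" by (cases a)
      show "ins (pick v) a = v a"
      proof (cases "k = i \<and> j < N")
        case True
        then show ?thesis
          using ext[of j] by (auto simp: a ins_def pick_def boson_row_def set_columns extensional_def fun_eq_iff)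
      next
        case False
        moreover have "v (i, j) = v0 (i, j)" if "\<not> j < N"
          using v v0 that by (auto simp: vertical_spins_def PiE_iff extensional_def)
        ultimately show ?thesis using v False by (cases "k = i") (auto simp: a ins_def)
      qed
    qed
    show "pick v \<in> ?Y"
      using v i by (auto simp: pick_def boson_row_def set_columns vertical_spins_def)
    have boson: "boson_row v k = boson_row v0 k" if "k \<noteq> i" for k
      using v that by (auto simp: boson_row_def)
    have row: "row_weight t x r (columns r N) \<alpha> U (pick v) \<gamma> = row_weight t x r (columns r N) \<alpha> U (boson_row v i) \<gamma>"
      "row_weight t y r (columns r N) \<beta> (pick v) U \<delta> = row_weight t y r (columns r N) \<beta> (boson_row v i) U \<delta>" for U
      by (auto simp: pick_def intro!: row_weight_cong)
    have "(\<Prod>k\<in>{1..r} - {i, i + 1}.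
         row_weight t (z k) r (columns r N) (l k) (boson_row v0 (k - 1)) (boson_row v0 k) (e k)) =
       (\<Prod>k\<in>{1..r} - {i, i + 1}.
         row_weight t (z k) r (columns r N) (l k) (boson_row v (k - 1)) (boson_row v k) (e k))"
      by (rule prod.cong[OF refl], subst (1 2) boson) auto
    then show "(\<Prod>k\<in>{1..r} - {i, i + 1}.
         row_weight t (z k) r (columns r N) (l k) (boson_row v0 (k - 1)) (boson_row v0 k) (e k)) *
       (row_weight t x r (columns r N) \<alpha> (boson_row v0 (i - 1)) (pick v) \<gamma> *
        row_weight t y r (columns r N) \<beta> (pick v) (boson_row v0 (i + 1)) \<delta>) =
       (\<Prod>k\<in>{1..r} - {i, i + 1}.
         row_weight t (z k) r (columns r N) (l k) (boson_row v (k - 1)) (boson_row v k) (e k)) *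
       (row_weight t x r (columns r N) \<alpha> (boson_row v (i - 1)) (boson_row v i) \<gamma> *
        row_weight t y r (columns r N) \<beta> (boson_row v i) (boson_row v (i + 1)) \<delta>)"
      using i by (simp add: row boson)
  qed (use mem pick_ins in auto)
  then show ?thesis
    by (simp add: double_row_weight_def sum_distrib_left)
qed

lemma adjacent_rows_exchange:
  assumes i: "1 \<le> i" "i < r"
    and sp: "\<alpha> \<in> hspins r" "\<beta> \<in> hspins r" "\<gamma> \<in> hspins r" "\<delta> \<in> hspins r"
    and V: "V = vertical_spins r N lam w3 w4"
  shows "R_diag t x y (1, r) \<alpha> \<beta> * adjacent_rows t r N V z l e i x y \<alpha> \<beta> \<gamma> \<delta> +
      R_cross t x y \<alpha> \<beta> * adjacent_rows t r N V z l e i x y \<beta> \<alpha> \<gamma> \<delta> =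
      adjacent_rows t r N V z l e i y x \<alpha> \<beta> \<gamma> \<delta> * R_diag t x y (1, r) \<gamma> \<delta> +
      adjacent_rows t r N V z l e i y x \<alpha> \<beta> \<delta> \<gamma> * R_cross t x y \<delta> \<gamma>"
proof -
  \<comment> \<open>\<open>g\<close> forgets the edges between rows \<open>i\<close> and
    \<open>i + 1\<close>; its fibres are the sets on which the exchange takes place.\<close>
  define g where "g v = (\<lambda>(k, j). if k = i then undefined else v (k, j))" for v :: "nat \<times> nat \<Rightarrow> label \<Rightarrow> nat"
  have fin: "finite V" by (simp add: V finite_vertical_spins)
  have group: "adjacent_rows t r N V z l e i a b c d c' d' =
      (\<Sum>u\<in>g ` V. adjacent_rows t r N {v \<in> V. g v = u} z l e i a b c d c' d')" for a b c d c' d'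
    unfolding adjacent_rows_def by (rule sum.group[OF fin finite_imageI[OF fin] order_refl, symmetric])
  have fibre: "R_diag t x y (1, r) \<alpha> \<beta> * adjacent_rows t r N {v \<in> V. g v = u} z l e i x y \<alpha> \<beta> \<gamma> \<delta> +
      R_cross t x y \<alpha> \<beta> * adjacent_rows t r N {v \<in> V. g v = u} z l e i x y \<beta> \<alpha> \<gamma> \<delta> =
      adjacent_rows t r N {v \<in> V. g v = u} z l e i y x \<alpha> \<beta> \<gamma> \<delta> * R_diag t x y (1, r) \<gamma> \<delta> +
      adjacent_rows t r N {v \<in> V. g v = u} z l e i y x \<alpha> \<beta> \<delta> \<gamma> * R_cross t x y \<delta> \<gamma>"
    if u: "u \<in> g ` V" for u
  proof -
    obtain v0 where v0: "v0 \<in> V" "u = g v0" using u by blast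
    have eq: "{v \<in> V. g v = u} = {v \<in> vertical_spins r N lam w3 w4. \<forall>k j. k \<noteq> i \<longrightarrow> v (k, j) = v0 (k, j)}"
      unfolding v0 V g_def by (auto simp: fun_eq_iff)
    \<comment> \<open>The edges above row \<open>i\<close> are bounded by
      \<open>r + (i - 1)\<close>, one less than the cutoff \<open>r + i\<close>; this gives the
      strict inequality that \<open>exchange\<close> asks for.\<close>
    have bound: "boson_row v0 (i - 1) q < r + i" if q_mem: "q \<in> set (columns r N)" for q
    proof -
      obtain j p where q: "q = (j, p)" "j < N" "p \<in> pairs r"
        using q_mem unfolding set_columns by fastforce
      have le: "\<forall>i\<le>r. \<forall>j<N. \<forall>p\<in>pairs r. v0 (i, j) p \<le> r + i"
        using v0 by (simp add: V vertical_spins_def)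
      have "v0 (i - 1, j) p \<le> r + (i - 1)"
        using i q by (intro le[rule_format]) auto
      then show ?thesis using i q by (simp add: boson_row_def)
    qed
    let ?D = "\<lambda>x y \<alpha> \<beta> \<gamma> \<delta>. double_row_weight t (r + i) x y r (columns r N) \<alpha> \<beta> (boson_row v0 (i - 1)) (boson_row v0 (i + 1)) \<gamma> \<delta>"
    let ?C = "\<Prod>k\<in>{1..r} - {i, i + 1}.
         row_weight t (z k) r (columns r N) (l k) (boson_row v0 (k - 1)) (boson_row v0 k) (e k)"
    note D = sum_fibre_eq_double_row_weight[OF v0(1)[unfolded V] i]
    have "?C * (R_diag t x y (1, r) \<alpha> \<beta> * ?D x y \<alpha> \<beta> \<gamma> \<delta> + R_cross t x y \<alpha> \<beta> * ?D x y \<beta> \<alpha> \<gamma> \<delta>) =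
      ?C * (?D y x \<alpha> \<beta> \<gamma> \<delta> * R_diag t x y (1, r) \<gamma> \<delta> + ?D y x \<alpha> \<beta> \<delta> \<gamma> * R_cross t x y \<delta> \<gamma>)"
      using exchangeD[OF exchange_columns sp bound] by (intro arg_cong2[of _ _ _ _ "(*)"] refl) simp
    then show ?thesis
      unfolding eq D by (simp only: distrib_left distrib_right mult_ac)
  qed
  show ?thesis
    unfolding group sum_distrib_left sum_distrib_right sum.distrib[symmetric]
    by (intro sum.cong refl fibre)
qed

section \<open>Simple reflections and the Bruhat order\<close>

text \<open>Multiplication by \<open>simple_refl i\<close> on the left swaps the values
  \<open>i\<close> and \<open>i + 1\<close>. As these are neighbors, only the inversion at their two
  positions is affected.\<close>

lemma perm_length_simple_refl_less:
  assumes w: "w permutes {1..r}" and i: "1 \<le> i" "i < r" and inv: "inv w (i + 1) < inv w i"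
  shows "perm_length r (simple_refl i \<circ> w) < perm_length r w"
proof -
  let ?I = "\<lambda>w. {(a, b). 1 \<le> a \<and> a < b \<and> b \<le> r \<and> (w a :: nat) > w b}"
  have inv_w: "w (inv w k) = k" "inv w (w k) = k" for k
    using w by (simp_all add: permutes_inverses)
  have "?I (simple_refl i \<circ> w) \<subseteq> ?I w"
  proof clarify
    fix a b assume ab: "1 \<le> a" "a < b" "b \<le> r" "(simple_refl i \<circ> w) b < (simple_refl i \<circ> w) a"
    have "w b < w a \<or> w a = i \<and> w b = i + 1"
      using ab(4) by (auto simp: simple_refl_def Transposition.transpose_def split: if_splits)
    then show "w b < w a"
      using ab(2) inv inv_w(2)[of a] inv_w(2)[of b] by auto
  qed
  moreover have "(inv w (i + 1), inv w i) \<in> ?I w - ?I (simple_refl i \<circ> w)"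
    using inv inv_permutes_mem[OF w, of i] inv_permutes_mem[OF w, of "i + 1"] i
    by (auto simp: inv_w simple_refl_def)
  ultimately have "?I (simple_refl i \<circ> w) \<subset> ?I w" by blast
  moreover have "finite (?I w)"
    by (rule finite_subset[of _ "{1..r} \<times> {1..r}"]) auto
  ultimately show ?thesis
    unfolding perm_length_def by (rule psubset_card_mono[rotated])
qed

lemma simple_refl_simple_refl [simp]: "simple_refl i \<circ> (simple_refl i \<circ> w) = w"
  by (simp add: simple_refl_def fun_eq_iff)

lemma simple_refl_permutes: "1 \<le> i \<Longrightarrow> i < r \<Longrightarrow> simple_refl i permutes {1..r}"
  unfolding simple_refl_def by (rule permutes_swap_id) auto

lemma simple_refl_comp_permutes:
  "w permutes {1..r} \<Longrightarrow> 1 \<le> i \<Longrightarrow> i < r \<Longrightarrow> (simple_refl i \<circ> w) permutes {1..r}"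
  by (intro permutes_compose simple_refl_permutes)

lemma inv_simple_refl_comp:
  assumes "w permutes {1..r}"
  shows "inv (simple_refl i \<circ> w) = inv w \<circ> simple_refl i"
proof -
  have "bij (simple_refl i)"
    by (simp add: simple_refl_def)
  moreover have "inv (simple_refl i) = simple_refl i"
    by (simp add: simple_refl_def)
  ultimately show ?thesis
    using o_inv_distrib[of "simple_refl i" w] permutes_bij[OF assms] by simp
qed

text \<open>Translates the Bruhat condition into a comparison of the boundary spins of rows
  \<open>i\<close> and \<open>i + 1\<close>, which is what the R-matrix sees. Length increases along
  Bruhat chains; if the inequality failed, \<open>simple_refl i \<circ> w\<close> would be longer
  than \<open>w\<close>.\<close>

lemma bruhat_less_simple_refl_iff:
  assumes w: "w permutes {1..r}" and i: "1 \<le> i" "i < r"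
  shows "bruhat_less r (simple_refl i \<circ> w) w \<longleftrightarrow> inv w (i + 1) < inv w i"
proof
  have len: "perm_length r u < perm_length r v" if "bruhat_less r u v" for u v
    using that unfolding bruhat_less_def by (induction rule: trancl_induct) auto
  assume less: "bruhat_less r (simple_refl i \<circ> w) w"
  show "inv w (i + 1) < inv w i"
  proof (rule ccontr)
    assume "\<not> inv w (i + 1) < inv w i"
    moreover have "inv w (i + 1) \<noteq> inv w i"
      using permutes_inj[OF permutes_inv[OF w]] by (simp add: inj_eq)
    ultimately have "inv (simple_refl i \<circ> w) (i + 1) < inv (simple_refl i \<circ> w) i"
      unfolding inv_simple_refl_comp[OF w] by (simp add: simple_refl_def)
    from perm_length_simple_refl_less[OF simple_refl_comp_permutes[OF w i] i this] len[OF less]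
    show False by simp
  qed
next
  assume "inv w (i + 1) < inv w i"
  then have "perm_length r (simple_refl i \<circ> w) < perm_length r w"
    by (rule perm_length_simple_refl_less[OF w i])
  moreover have "i \<in> {1..r}" "i + 1 \<in> {1..r}" "i \<noteq> i + 1 \<and> w = Transposition.transpose i (i + 1) \<circ> (simple_refl i \<circ> w)"
    using i by (simp_all add: simple_refl_def fun_eq_iff)
  then have "\<exists>a\<in>{1..r}. \<exists>b\<in>{1..r}. a \<noteq> b \<and> w = Transposition.transpose a b \<circ> (simple_refl i \<circ> w)"
    by blast
  ultimately show "bruhat_less r (simple_refl i \<circ> w) w"
    unfolding bruhat_less_def using simple_refl_comp_permutes[OF w i]
    by (intro r_into_trancl CollectI case_prodI conjI)
qed

text \<open>Passing from \<open>w\<close> to \<open>simple_refl i \<circ> w\<close> swaps the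
  boundary spins of the two rows, so the four terms of \<open>adjacent_rows_exchange\<close> are
  those of the recurrence.\<close>

lemma four_term_recurrence_nonzero:
  assumes w: "w1 permutes {1..r}" "w2 permutes {1..r}" and i: "1 \<le> i" "i < r"
    and nz: "z i \<noteq> 0" "z (i + 1) \<noteq> 0"
  shows "rec_lhs t r (partition_function t r N lam w3 w4) i w1 w2 z =
    rec_rhs t r (partition_function t r N lam w3 w4) i w1 w2 z"
proof -
  let ?Z = "partition_function t r N lam w3 w4"
  let ?V = "vertical_spins r N lam w3 w4"
  let ?s = "simple_refl i"
  let ?A = "adjacent_rows t r N ?V z (\<lambda>k. Dolor (inv w2 k)) (\<lambda>k. Color (inv w1 k)) i"
  define a b c d where abcd: "a = inv w2 i" "b = inv w2 (i + 1)" "c = inv w1 i" "d = inv w1 (i + 1)"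
  define x y where xy: "x = z i" "y = z (i + 1)"
  have ran: "a \<in> {1..r}" "b \<in> {1..r}" "c \<in> {1..r}" "d \<in> {1..r}"
    using inv_permutes_mem[OF w(1)] inv_permutes_mem[OF w(2)] i by (auto simp: abcd)
  have neq: "a \<noteq> b" "c \<noteq> d"
    using permutes_inj[OF permutes_inv[OF w(1)]] permutes_inj[OF permutes_inv[OF w(2)]]
    by (simp_all add: abcd inj_eq)
  have s: "?s i = i + 1" "?s (i + 1) = i" "?s (Suc i) = i" "\<And>k. k \<notin> {i, i + 1} \<Longrightarrow> ?s k = k"
    by (auto simp: simple_refl_def)
  note sw = simple_refl_comp_permutes[OF w(1) i] simple_refl_comp_permutes[OF w(2) i]
  note inv_s = inv_simple_refl_comp[OF w(1)] inv_simple_refl_comp[OF w(2)]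
  have Z: "?Z w1 w2 z = ?A x y (Dolor a) (Dolor b) (Color c) (Color d)"
    unfolding abcd xy by (rule partition_function_eq_adjacent_rows[OF w i]) auto
  have Z2: "?Z w1 (?s \<circ> w2) z = ?A x y (Dolor b) (Dolor a) (Color c) (Color d)"
    using partition_function_eq_adjacent_rows[OF w(1) sw(2) i, of z z "\<lambda>k. Dolor (inv w2 k)" "\<lambda>k. Color (inv w1 k)"]
    by (simp add: inv_s s abcd xy)
  have Zs: "?Z w1 w2 (z \<circ> ?s) = ?A y x (Dolor a) (Dolor b) (Color c) (Color d)"
    using partition_function_eq_adjacent_rows[OF w i, of z "z \<circ> ?s" "\<lambda>k. Dolor (inv w2 k)" "\<lambda>k. Color (inv w1 k)"]
    by (simp add: s abcd xy)
  have Z1s: "?Z (?s \<circ> w1) w2 (z \<circ> ?s) = ?A y x (Dolor a) (Dolor b) (Color d) (Color c)"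
    using partition_function_eq_adjacent_rows[OF sw(1) w(2) i, of z "z \<circ> ?s" "\<lambda>k. Dolor (inv w2 k)" "\<lambda>k. Color (inv w1 k)"]
    by (simp add: inv_s s abcd xy)
  \<comment> \<open>At the label \<open>(1, r)\<close> no two dolors and no two colors are
    separated, so \<open>diag_exp\<close> is 2 or 1 by their order alone.\<close>
  have dolors: "R_diag t x y (1, r) (Dolor a) (Dolor b) = x * y * (if b < a then (1 - t) * x else (1 - t) * y)"
    "R_cross t x y (Dolor a) (Dolor b) = x * y * (if b < a then x - y else t * (x - y))"
    using ran neq by (auto simp: R_diag_def R_cross_def power2_eq_square)
  have colors: "R_diag t x y (1, r) (Color c) (Color d) = x * y * (if d < c then (1 - t) * x else (1 - t) * y)"
    "R_cross t x y (Color d) (Color c) = x * y * (if d < c then x - y else t * (x - y))"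
    using ran neq by (auto simp: R_diag_def R_cross_def power2_eq_square)
  have "x * y * rec_lhs t r ?Z i w1 w2 z =
      R_diag t x y (1, r) (Dolor a) (Dolor b) * ?A x y (Dolor a) (Dolor b) (Color c) (Color d) +
      R_cross t x y (Dolor a) (Dolor b) * ?A x y (Dolor b) (Dolor a) (Color c) (Color d)"
    unfolding rec_lhs_def bruhat_less_simple_refl_iff[OF w(2) i] dolors Z Z2 abcd[symmetric] xy[symmetric]
    by (simp add: algebra_simps)
  also have "\<dots> = ?A y x (Dolor a) (Dolor b) (Color c) (Color d) * R_diag t x y (1, r) (Color c) (Color d) +
      ?A y x (Dolor a) (Dolor b) (Color d) (Color c) * R_cross t x y (Color d) (Color c)"
    using ran by (intro adjacent_rows_exchange[OF i _ _ _ _ refl]) (auto simp: hspins_def)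
  also have "\<dots> = x * y * rec_rhs t r ?Z i w1 w2 z"
    unfolding rec_rhs_def Let_def bruhat_less_simple_refl_iff[OF w(1) i] colors Zs Z1s abcd[symmetric] xy[symmetric]
    by (simp add: algebra_simps)
  finally show ?thesis using nz by (simp add: xy)
qed

section \<open>Continuity and reduction to generic parameters\<close>

lemma continuous_on_if_const:
  "(P \<Longrightarrow> continuous_on S f) \<Longrightarrow> (\<not> P \<Longrightarrow> continuous_on S g) \<Longrightarrow>
   continuous_on S (\<lambda>x. if P then f x else g x)"
  by (cases P) simp_all

lemma continuous_on_admissible_weight:
  fixes f g :: "'b::topological_space \<Rightarrow> complex"
  assumes "continuous_on S f" "continuous_on S g"
  shows "continuous_on S (\<lambda>x. admissible_weight (f x) (g x) p l n e)"
  using assms by (cases p; cases l; cases e)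
    (auto intro!: continuous_intros continuous_on_if_const simp del: power_Suc)

text \<open>Admissibility and the interior path depend on neither parameter; the conditionals have
  constant conditions, and what remains is a product of continuous functions.\<close>

lemma continuous_on_fused_weight:
  fixes f g :: "'b::topological_space \<Rightarrow> complex"
  assumes "continuous_on S f" "continuous_on S g"
  shows "continuous_on S (\<lambda>x. fused_weight (f x) (g x) r l tp bt e)"
  unfolding fused_weight_def unfused_weight_def Let_def
  by (intro continuous_on_if_const continuous_intros continuous_on_admissible_weight assms)

lemma continuous_on_partition_function:
  fixes f :: "'b::topological_space \<Rightarrow> complex"
  assumes "continuous_on S f" "\<And>i. continuous_on S (\<lambda>x. g x i)"
  shows "continuous_on S (\<lambda>x. partition_function (f x) r N lam w3 w4 w1 w2 (g x))"
  unfolding partition_function_def state_weight_def case_prod_unfold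
  by (intro continuous_intros continuous_on_fused_weight assms)

lemma eventually_affine_neq_0:
  fixes u c :: complex
  assumes "c \<noteq> 0"
  shows "eventually (\<lambda>\<epsilon>. u + c * \<epsilon> \<noteq> 0) (at 0)"
proof (cases "u = 0")
  case True
  then show ?thesis
    using assms by (auto simp: eventually_at intro!: exI[of _ 1])
next
  case False
  have "((\<lambda>\<epsilon>. u + c * \<epsilon>) \<longlongrightarrow> u + c * 0) (at 0)"
    by (intro tendsto_intros)
  then show ?thesis
    using False by (intro tendsto_imp_eventually_ne) auto
qed

text \<open>Moving the coordinates of a point at different speeds makes them pairwise distinct and
  nonzero at once.\<close>

lemma cspace_perturbation:
  assumes z: "z \<in> cspace r"
  obtains \<phi> :: "complex \<Rightarrow> nat \<Rightarrow> complex"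
  where "continuous_on UNIV \<phi>" "\<phi> 0 = z" "\<And>\<epsilon>. \<phi> \<epsilon> \<in> cspace r"
    "eventually (\<lambda>\<epsilon>. inj_on (\<phi> \<epsilon>) {1..r} \<and> (\<forall>k\<in>{1..r}. \<phi> \<epsilon> k \<noteq> 0)) (at 0)"
proof -
  \<comment> \<open>Coordinate \<open>k\<close> moves with speed \<open>k\<close>: the speeds are
    pairwise distinct, and nonzero because \<open>k \<ge> 1\<close>.\<close>
  define \<phi> where "\<phi> \<epsilon> k = (if k \<in> {1..r} then z k + of_nat k * \<epsilon> else undefined)" for \<epsilon> :: complex and k
  have cont: "continuous_on UNIV \<phi>"
  proof (rule continuous_on_coordinatewise_then_product)
    show "continuous_on UNIV (\<lambda>\<epsilon>. \<phi> \<epsilon> k)" for k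
      by (cases "k \<in> {1..r}") (auto simp: \<phi>_def intro!: continuous_intros)
  qed
  have at_0: "\<phi> 0 = z"
    using z by (auto simp: \<phi>_def cspace_def PiE_def extensional_def)
  have mem: "\<phi> \<epsilon> \<in> cspace r" for \<epsilon>
    by (auto simp: \<phi>_def cspace_def)
  have "eventually (\<lambda>\<epsilon>. k \<noteq> m \<longrightarrow> (z k - z m) + (of_nat k - of_nat m) * \<epsilon> \<noteq> 0) (at 0)" for k m
    using eventually_affine_neq_0[of "of_nat k - of_nat m" "z k - z m"] by (cases "k = m") auto
  moreover have "eventually (\<lambda>\<epsilon>. z k + of_nat k * \<epsilon> \<noteq> 0) (at 0)" if "k \<in> {1..r}" for k
    using that by (intro eventually_affine_neq_0) auto
  ultimately have "eventually (\<lambda>\<epsilon>. \<forall>k\<in>{1..r}. (\<forall>m\<in>{1..r}. k \<noteq> m \<longrightarrow> (z k - z m) + (of_nat k - of_nat m) * \<epsilon> \<noteq> 0) \<and>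
      z k + of_nat k * \<epsilon> \<noteq> 0) (at 0)"
    by (simp only: eventually_ball_finite_distrib[OF finite_atLeastAtMost] eventually_conj_iff) blast
  then have "eventually (\<lambda>\<epsilon>. inj_on (\<phi> \<epsilon>) {1..r} \<and> (\<forall>k\<in>{1..r}. \<phi> \<epsilon> k \<noteq> 0)) (at 0)"
    by (rule eventually_mono) (auto simp: \<phi>_def inj_on_def algebra_simps)
  from that[of \<phi>, OF cont at_0 mem this] show ?thesis .
qed

lemma continuous_eq_if_eventually_eq:
  fixes f g :: "complex \<Rightarrow> complex"
  assumes "continuous_on UNIV f" "continuous_on UNIV g" "eventually (\<lambda>\<epsilon>. f \<epsilon> = g \<epsilon>) (at 0)"
  shows "f 0 = g 0"
proof -
  have "(f \<longlongrightarrow> f 0) (at 0)" "(g \<longlongrightarrow> g 0) (at 0)"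
    using assms(1,2) by (simp_all add: continuous_on_eq_continuous_at isCont_def)
  then show ?thesis
    using tendsto_unique[of "at (0::complex)" f "f 0" "g 0"] tendsto_cong[OF assms(3)] by auto
qed

lemma eq_on_cspace_if_eq_generic:
  fixes F G :: "(nat \<Rightarrow> complex) \<Rightarrow> complex"
  assumes "continuous_on (cspace r) F" "continuous_on (cspace r) G" "z \<in> cspace r"
    and eq: "\<And>z. z \<in> cspace r \<Longrightarrow> inj_on z {1..r} \<Longrightarrow> (\<And>k. k \<in> {1..r} \<Longrightarrow> z k \<noteq> 0) \<Longrightarrow> F z = G z"
  shows "F z = G z"
proof -
  obtain \<phi> :: "complex \<Rightarrow> nat \<Rightarrow> complex" where \<phi>: "continuous_on UNIV \<phi>" "\<phi> 0 = z" "\<And>\<epsilon>. \<phi> \<epsilon> \<in> cspace r"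
      "eventually (\<lambda>\<epsilon>. inj_on (\<phi> \<epsilon>) {1..r} \<and> (\<forall>k\<in>{1..r}. \<phi> \<epsilon> k \<noteq> 0)) (at 0)"
    using cspace_perturbation[OF assms(3)] by blast
  have "F (\<phi> 0) = G (\<phi> 0)"
  proof (rule continuous_eq_if_eventually_eq)
    show "continuous_on UNIV (\<lambda>\<epsilon>. F (\<phi> \<epsilon>))" "continuous_on UNIV (\<lambda>\<epsilon>. G (\<phi> \<epsilon>))"
      using \<phi>(3) by (auto intro!: continuous_on_compose2[OF assms(1) \<phi>(1)] continuous_on_compose2[OF assms(2) \<phi>(1)])
    show "eventually (\<lambda>\<epsilon>. F (\<phi> \<epsilon>) = G (\<phi> \<epsilon>)) (at 0)"
      using \<phi>(4) by (rule eventually_mono) (auto intro!: eq \<phi>(3))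
  qed
  then show ?thesis by (simp add: \<phi>(2))
qed

text \<open>Here \<open>t\<close> moves too, as \<open>t + \<epsilon>\<close>, so that
  \<open>t = 0\<close> is approached through nonzero values.\<close>

lemma eq_if_eq_generic:
  fixes F G :: "complex \<times> (nat \<Rightarrow> complex) \<Rightarrow> complex"
  assumes "continuous_on (UNIV \<times> cspace r) F" "continuous_on (UNIV \<times> cspace r) G" "z \<in> cspace r"
    and eq: "\<And>t z. z \<in> cspace r \<Longrightarrow> t \<noteq> 0 \<Longrightarrow> inj_on z {1..r} \<Longrightarrow> F (t, z) = G (t, z)"
  shows "F (t, z) = G (t, z)"
proof -
  obtain \<phi> :: "complex \<Rightarrow> nat \<Rightarrow> complex" where \<phi>: "continuous_on UNIV \<phi>" "\<phi> 0 = z" "\<And>\<epsilon>. \<phi> \<epsilon> \<in> cspace r"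
      "eventually (\<lambda>\<epsilon>. inj_on (\<phi> \<epsilon>) {1..r} \<and> (\<forall>k\<in>{1..r}. \<phi> \<epsilon> k \<noteq> 0)) (at 0)"
    using cspace_perturbation[OF assms(3)] by blast
  have \<psi>: "continuous_on UNIV (\<lambda>\<epsilon>. (t + \<epsilon>, \<phi> \<epsilon>))"
    by (intro continuous_intros \<phi>(1))
  have "F (t + 0, \<phi> 0) = G (t + 0, \<phi> 0)"
  proof (rule continuous_eq_if_eventually_eq)
    show "continuous_on UNIV (\<lambda>\<epsilon>. F (t + \<epsilon>, \<phi> \<epsilon>))" "continuous_on UNIV (\<lambda>\<epsilon>. G (t + \<epsilon>, \<phi> \<epsilon>))"
      using \<phi>(3) by (auto intro!: continuous_on_compose2[OF assms(1) \<psi>] continuous_on_compose2[OF assms(2) \<psi>])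
    show "eventually (\<lambda>\<epsilon>. F (t + \<epsilon>, \<phi> \<epsilon>) = G (t + \<epsilon>, \<phi> \<epsilon>)) (at 0)"
      using eventually_conj[OF \<phi>(4) eventually_affine_neq_0[of 1 t]] by (rule eventually_mono) (auto intro!: eq \<phi>(3))
  qed
  then show ?thesis by (simp add: \<phi>(2))
qed

lemma continuous_on_coordinate_cspace: "continuous_on S (\<lambda>z. z i :: complex)"
  by (rule continuous_on_subset[OF continuous_on_product_coordinates]) simp

lemma four_term_recurrence_partition_function:
  "four_term_recurrence t r (partition_function t r N lam w3 w4)"
  unfolding four_term_recurrence_def
proof (intro allI ballI impI, elim conjE)
  fix i w1 w2 z
  assume z: "z \<in> cspace r" and i: "1 \<le> i" "i < r" and w: "w1 permutes {1..r}" "w2 permutes {1..r}"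
  let ?Z = "partition_function t r N lam w3 w4"
  have Z: "continuous_on (cspace r) (\<lambda>z. ?Z u v z)" "continuous_on (cspace r) (\<lambda>z. ?Z u v (z \<circ> simple_refl i))" for u v
    by (auto intro!: continuous_on_partition_function continuous_intros continuous_on_coordinate_cspace)
  show "rec_lhs t r ?Z i w1 w2 z = rec_rhs t r ?Z i w1 w2 z"
  proof (rule eq_on_cspace_if_eq_generic[OF _ _ z])
    show "continuous_on (cspace r) (rec_lhs t r ?Z i w1 w2)"
      unfolding rec_lhs_def[abs_def]
      by (cases "bruhat_less r (simple_refl i \<circ> w2) w2")
        (auto intro!: continuous_intros Z continuous_on_coordinate_cspace)
    show "continuous_on (cspace r) (rec_rhs t r ?Z i w1 w2)"
      unfolding rec_rhs_def[abs_def] Let_def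
      by (cases "bruhat_less r (simple_refl i \<circ> w1) w1")
        (auto intro!: continuous_intros Z continuous_on_coordinate_cspace)
  qed (use i in \<open>auto intro!: four_term_recurrence_nonzero w\<close>)
qed

section \<open>Systems with at most one state\<close>

text \<open>A recursive necessary condition for a row to have a path, so that a spin can be followed
  vertex by vertex from the left.\<close>

primrec row_admissible ::
    "('a \<times> label) list \<Rightarrow> spin \<Rightarrow> ('a \<times> label \<Rightarrow> nat) \<Rightarrow> ('a \<times> label \<Rightarrow> nat) \<Rightarrow> spin \<Rightarrow> bool" where
  "row_admissible [] l U V e \<longleftrightarrow> l = e"
| "row_admissible (q # qs) l U V e \<longleftrightarrow>
     (\<exists>m. unfused_admissible (snd q) l (U q) (V q) m \<and> row_admissible qs m U V e)"

lemma row_admissible_append: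
  "row_admissible (ps @ qs) l U V e \<longleftrightarrow> (\<exists>m. row_admissible ps l U V m \<and> row_admissible qs m U V e)"
  by (induction ps arbitrary: l) auto

lemma row_admissible_right_unique:
  "row_admissible qs l U V e \<Longrightarrow> row_admissible qs l U V e' \<Longrightarrow> e = e'"
  by (induction qs arbitrary: l) (auto dest: unfused_admissible_right_unique)

lemma row_admissible_if_row_path:
  "row_path r qs l U V e hs \<Longrightarrow> row_admissible qs l U V e"
proof (induction qs arbitrary: l hs)
  case Nil
  then show ?case by (auto simp: row_path_def)
next
  case (Cons q qs)
  then obtain h h' hs' where hs: "hs = h # h' # hs'"
    by (auto simp: row_path_def length_Suc_conv)
  show ?case using Cons unfolding hs row_path_Cons by auto
qed

lemma row_admissible_if_fused_admissible:
  assumes "fused_admissible r l tp bt e"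
    and "\<And>p. p \<in> pairs r \<Longrightarrow> tp p = U (j, p)" "\<And>p. p \<in> pairs r \<Longrightarrow> bt p = V (j, p)"
  shows "row_admissible (map (Pair j) (pair_list r)) l U V e"
proof -
  obtain hs where "fused_internal r l tp bt e hs"
    using assms(1) by (auto simp: fused_admissible_def)
  also have "fused_internal r l tp bt e hs \<longleftrightarrow> row_path r (map (Pair j) (pair_list r)) l U V e hs"
    using assms(2,3) by (rule fused_internal_iff_row_path)
  finally show ?thesis
    by (rule row_admissible_if_row_path)
qed

lemma row_admissible_columns:
  assumes "\<And>j. j < N \<Longrightarrow> fused_admissible r (g (j + 1)) (u j) (v j) (g j)"
    and "\<And>j p. j < N \<Longrightarrow> p \<in> pairs r \<Longrightarrow> u j p = U (j, p)" "\<And>j p. j < N \<Longrightarrow> p \<in> pairs r \<Longrightarrow> v j p = V (j, p)"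
  shows "row_admissible (columns r N) (g N) U V (g 0)"
  using assms
proof (induction N)
  case (Suc N)
  have "row_admissible (map (Pair N) (pair_list r)) (g (N + 1)) U V (g N)"
    using Suc.prems by (intro row_admissible_if_fused_admissible[of r _ "u N" "v N"]) auto
  then show ?case using Suc by (auto simp: row_admissible_append)
qed simp

text \<open>A dolor changes only by absorbing a boson from above.\<close>

lemma row_admissible_dolor_without_bosons:
  "row_admissible qs (Dolor x) U V e \<Longrightarrow> (\<And>q. q \<in> set qs \<Longrightarrow> U q = 0) \<Longrightarrow> e = Dolor x"
proof (induction qs)
  case (Cons q qs)
  obtain m where m: "unfused_admissible (snd q) (Dolor x) (U q) (V q) m" "row_admissible qs m U V e"
    using Cons.prems(1) by auto
  moreover have "U q = 0" using Cons.prems(2) by simp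
  ultimately have "m = Dolor x" by (cases "snd q"; cases m) auto
  then show ?case using m Cons by auto
qed simp

text \<open>A deposit would turn the color into a dolor for good: the deposited boson lies below the
  row, and there is none above to absorb.\<close>

lemma row_admissible_color_without_bosons:
  assumes "row_admissible qs (Color a) U V (Color b)" "\<And>q. q \<in> set qs \<Longrightarrow> U q = 0" "q \<in> set qs"
  shows "V q = 0"
  using assms
proof (induction qs)
  case (Cons q' qs)
  obtain m where m: "unfused_admissible (snd q') (Color a) (U q') (V q') m" "row_admissible qs m U V (Color b)"
    using Cons.prems(1) by auto
  have "m \<noteq> Dolor x" for x
    using m(2) row_admissible_dolor_without_bosons[of qs x U V "Color b"] Cons.prems(2) by auto
  then obtain a' where a': "m = Color a'" by (cases m) auto
  then have "V q' = 0" "a' = a"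
    using m(1) Cons.prems(2)[of q'] by (cases "snd q'"; simp)+
  then show ?case using Cons m a' by auto
qed simp

text \<open>If the only boson that a dolor can meet is the rightmost one, then it has to absorb it: a
  dolor that passed it, or a color deposited further to the right, could not be completed to a row
  ending in a color.\<close>

lemma row_admissible_absorb_last:
  assumes "row_admissible (ps @ q # qs) (Dolor x) U V (Color e)" "snd q = (c, x)"
    and "\<And>q. q \<in> set ps \<Longrightarrow> snd (snd q) = x \<Longrightarrow> U q = 0" "\<And>q. q \<in> set qs \<Longrightarrow> U q = 0"
  shows "V q = U q - 1" and "\<And>q'. q' \<in> set ps \<Longrightarrow> V q' = U q'" and "\<And>q'. q' \<in> set qs \<Longrightarrow> V q' = U q'"
proof -
  have "row_admissible (q # qs) (Dolor x) U V (Color e) \<and> (\<forall>q'\<in>set ps. V q' = U q')"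
    using assms(1,3)
  proof (induction ps)
    case (Cons p ps)
    obtain m where m: "unfused_admissible (snd p) (Dolor x) (U p) (V p) m"
        "row_admissible (ps @ q # qs) m U V (Color e)"
      using Cons.prems(1) by auto
    then have "m = Dolor x \<and> V p = U p"
      using Cons.prems(2)[of p] by (cases "snd p"; cases m) auto
    then show ?case using Cons m by auto
  qed simp
  then show "\<And>q'. q' \<in> set ps \<Longrightarrow> V q' = U q'"
    and "V q = U q - 1" and "\<And>q'. q' \<in> set qs \<Longrightarrow> V q' = U q'"
  proof -
    assume *: "row_admissible (q # qs) (Dolor x) U V (Color e) \<and> (\<forall>q'\<in>set ps. V q' = U q')"
    then show "\<And>q'. q' \<in> set ps \<Longrightarrow> V q' = U q'" by blast
    obtain m where m: "unfused_admissible (snd q) (Dolor x) (U q) (V q) m" "row_admissible qs m U V (Color e)"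
      using * by auto
    have "m \<noteq> Dolor y" for y
      using m(2) row_admissible_dolor_without_bosons[of qs y U V "Color e"] assms(4) by auto
    then obtain a where a: "m = Color a" by (cases m) auto
    then show "V q = U q - 1"
      using m(1) assms(2) by simp
    show "V q' = U q'" if "q' \<in> set qs" for q'
      using row_admissible_color_without_bosons[OF m(2)[unfolded a] assms(4) that] assms(4)[OF that] by simp
  qed
qed

text \<open>Vertical spins and left boundary determine the horizontal spins from left to
  right.\<close>

lemma states_eqI:
  assumes s: "(h, v) \<in> states r N lam w1 w2 w3 w4" and s': "(h', v') \<in> states r N lam w1 w2 w3 w4"
    and v: "\<And>i j p. i \<le> r \<Longrightarrow> j < N \<Longrightarrow> p \<in> pairs r \<Longrightarrow> v (i, j) p = v' (i, j) p"
  shows "(h, v) = (h', v')"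
proof -
  have mem: "v \<in> {0..r} \<times> {0..<N} \<rightarrow>\<^sub>E (pairs r \<rightarrow>\<^sub>E UNIV)" "v' \<in> {0..r} \<times> {0..<N} \<rightarrow>\<^sub>E (pairs r \<rightarrow>\<^sub>E UNIV)"
      "h \<in> {1..r} \<times> {0..N} \<rightarrow>\<^sub>E hspins r" "h' \<in> {1..r} \<times> {0..N} \<rightarrow>\<^sub>E hspins r"
    using s s' by (simp_all add: states_def)
  have vv: "v = v'"
  proof (rule PiE_ext[OF mem(1,2)])
    fix a assume a: "a \<in> {0..r} \<times> {0..<N}"
    show "v a = v' a"
      by (rule PiE_ext[OF PiE_mem[OF mem(1) a] PiE_mem[OF mem(2) a]]) (use a v in auto)
  qed
  have adm: "fused_admissible r (h (i, j + 1)) (v (i - 1, j)) (v (i, j)) (h (i, j))"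
      "fused_admissible r (h' (i, j + 1)) (v (i - 1, j)) (v (i, j)) (h' (i, j))" if "i \<in> {1..r}" "j < N" for i j
    using s s' that by (simp_all add: states_def vv)
  have hh: "h (i, j) = h' (i, j)" if "i \<in> {1..r}" "j \<le> N" for i j
    using that(2)
  \<comment> \<open>Downward from \<open>N\<close>, since columns are numbered from right to
    left.\<close>
  proof (induction j rule: inc_induct)
    case base
    show ?case using s s' that(1) by (simp add: states_def)
  next
    case (step j)
    show ?case
      using row_admissible_if_fused_admissible[OF adm(1)[OF that(1) step.hyps(2)], of "boson_row v (i - 1)" j "boson_row v i"]
        row_admissible_if_fused_admissible[OF adm(2)[OF that(1) step.hyps(2)], of "boson_row v (i - 1)" j "boson_row v i"]
        step.IH by (intro row_admissible_right_unique) (auto simp: boson_row_def)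
  qed
  have "h = h'"
    by (rule PiE_ext[OF mem(3,4)]) (use hh in auto)
  with vv show ?thesis by simp
qed

definition column_less :: "nat \<times> label \<Rightarrow> nat \<times> label \<Rightarrow> bool" where
  "column_less q q' \<longleftrightarrow> fst q > fst q' \<or> fst q = fst q' \<and> pair_less (snd q) (snd q')"

lemma sorted_wrt_columns: "sorted_wrt column_less (columns r N)"
proof (induction N)
  case (Suc N)
  have "sorted_wrt column_less (map (Pair N) (pair_list r))"
    using sorted_wrt_pair_list by (simp add: sorted_wrt_map column_less_def)
  then show ?case
    using Suc by (simp add: sorted_wrt_append set_columns) (auto simp: column_less_def)
qed simp

lemma long_element_permutes: "long_element r permutes {1..r}"
proof (rule bij_imp_permutes)
  show "bij_betw (long_element r) {1..r} {1..r}"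
    by (rule bij_betw_byWitness[where f' = "long_element r"]) (auto simp: long_element_def)
qed (auto simp: long_element_def)

lemma ex_sorting_permutation:
  fixes f :: "nat \<Rightarrow> nat"
  obtains \<sigma> where "\<sigma> permutes {1..r}" "\<And>k m. 1 \<le> k \<Longrightarrow> k \<le> m \<Longrightarrow> m \<le> r \<Longrightarrow> f (\<sigma> k) \<le> f (\<sigma> m)"
proof -
  define xs where "xs = sort_key f [1..<Suc r]"
  have xs: "set xs = {1..r}" "distinct xs" "length xs = r" "sorted (map f xs)"
    by (auto simp: xs_def simp del: upt_Suc)
  define \<sigma> where "\<sigma> k = (if k \<in> {1..r} then xs ! (k - 1) else k)" for k
  have "bij_betw ((!) xs) {..<r} {1..r}"
    using xs by (intro bij_betw_nth) auto
  moreover have "bij_betw (\<lambda>k. k - 1) {1..r} {..<r}"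
    by (rule bij_betw_byWitness[where f' = Suc]) auto
  ultimately have "bij_betw ((!) xs \<circ> (\<lambda>k. k - 1)) {1..r} {1..r}"
    by (rule bij_betw_trans[rotated])
  then have "bij_betw \<sigma> {1..r} {1..r}"
    by (rule bij_betw_cong[THEN iffD1, rotated]) (simp add: \<sigma>_def)
  then have perm: "\<sigma> permutes {1..r}"
    by (rule bij_imp_permutes) (auto simp: \<sigma>_def)
  have "f (\<sigma> k) \<le> f (\<sigma> m)" if "1 \<le> k" "k \<le> m" "m \<le> r" for k m
    using sorted_nth_mono[OF xs(4), of "k - 1" "m - 1"] that xs(3) by (simp add: \<sigma>_def)
  with perm show ?thesis by (rule that)
qed

text \<open>The dolors enter in the order in which their bosons are met from the right, so that in
  each row the entering dolor finds only its own boson, which is the rightmost one left.\<close>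

lemma ex_permutation_with_small_systems:
  assumes w: "w3 permutes {1..r}" "w4 permutes {1..r}" and lam: "\<And>i. i \<in> {1..r} \<Longrightarrow> lam i < N"
  obtains w2 where "w2 permutes {1..r}"
    "\<And>w1 s s'. s \<in> states r N lam w1 w2 w3 w4 \<Longrightarrow> s' \<in> states r N lam w1 w2 w3 w4 \<Longrightarrow> s = s'"
proof -
  define c where "c = inv w3"
  define d where "d i = inv w4 (long_element r i)" for i
  have d_perm: "d permutes {1..r}"
    using permutes_compose[OF long_element_permutes permutes_inv[OF w(2)]] by (simp add: d_def[abs_def] comp_def)
  have ran: "c i \<in> {1..r}" "d i \<in> {1..r}" if "i \<in> {1..r}" for i
    using permutes_in_image[OF d_perm] inv_permutes_mem[OF w(1)] that by (auto simp: c_def)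
  have d_inj: "d i = d i' \<Longrightarrow> i = i'" for i i'
    using permutes_inj[OF d_perm] by (simp add: inj_eq)
  \<comment> \<open>As \<open>d i < Suc r\<close>, the key is lexicographic in the column and the
    dolor. Both decrease from left to right, so increasing keys list the bosons from the
    right.\<close>
  obtain \<sigma> where \<sigma>: "\<sigma> permutes {1..r}"
      "\<And>k m. 1 \<le> k \<Longrightarrow> k \<le> m \<Longrightarrow> m \<le> r \<Longrightarrow> lam (\<sigma> k) * Suc r + d (\<sigma> k) \<le> lam (\<sigma> m) * Suc r + d (\<sigma> m)"
    using ex_sorting_permutation[of r "\<lambda>i. lam i * Suc r + d i"] by blast
  \<comment> \<open>Chosen so that the dolor of boson \<open>\<sigma> k\<close> enters in row
    \<open>k\<close>.\<close>
  define w2 where "w2 = inv (d \<circ> \<sigma>)"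
  have d\<sigma>: "(d \<circ> \<sigma>) permutes {1..r}"
    by (rule permutes_compose[OF \<sigma>(1) d_perm])
  then have w2: "w2 permutes {1..r}" "inv w2 k = d (\<sigma> k)" for k
    using permutes_inv[OF d\<sigma>] permutes_inv_inv[OF d\<sigma>] by (simp_all add: w2_def)
  \<comment> \<open>The bosons left after \<open>k\<close> rows. That every state has these
    multiplicities, with no reference to \<open>w1\<close>, is the reason for uniqueness.\<close>
  define rest where "rest k j p = card {i\<in>{1..r}. lam i = j \<and> (c i, d i) = p \<and> i \<notin> \<sigma> ` {1..k}}" for k j p
  have bosons: "v (k, j) p = rest k j p"
    if s: "(h, v) \<in> states r N lam w1 w2 w3 w4" and "k \<le> r" "j < N" "p \<in> pairs r" for h v w1 k j p
    using that(2-)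
  proof (induction k arbitrary: j p)
    case 0
    then show ?case
      using s by (simp add: states_def rest_def c_def d_def)
  next
    case (Suc k)
    define a where "a = \<sigma> (Suc k)"
    define q where "q = (lam a, (c a, d a))"
    have a: "a \<in> {1..r}"
      using permutes_in_image[OF \<sigma>(1), of "Suc k"] Suc.prems(1) by (simp add: a_def)
    have q: "q \<in> set (columns r N)"
      using a ran[OF a] lam[OF a] by (simp add: q_def set_columns pairs_def)
    then obtain ps qs where pqs: "columns r N = ps @ q # qs"
      by (metis split_list)
    have set_pqs: "set ps \<union> {q} \<union> set qs = {..<N} \<times> pairs r"
      using arg_cong[OF pqs, of set] by (auto simp: set_columns)
    have IH: "boson_row v k q' = rest k (fst q') (snd q')" if "q' \<in> set (columns r N)" for q'
      using Suc.IH[of "fst q'" "snd q'"] Suc.prems(1) that by (auto simp: boson_row_def set_columns split: prod.splits)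
    have rest_0: "rest k (fst q') (snd q') = 0" if "\<And>i. i \<in> {1..r} \<Longrightarrow> q' = (lam i, (c i, d i)) \<Longrightarrow> i \<in> \<sigma> ` {1..k}" for q'
      unfolding rest_def using that by (cases q') auto
    have "row_admissible (columns r N) (h (Suc k, N)) (boson_row v k) (boson_row v (Suc k)) (h (Suc k, 0))"
    proof (rule row_admissible_columns[where g = "\<lambda>j. h (Suc k, j)" and u = "\<lambda>j. v (k, j)" and v = "\<lambda>j. v (Suc k, j)"])
      have "\<forall>i\<in>{1..r}. \<forall>j<N. fused_admissible r (h (i, j + 1)) (v (i - 1, j)) (v (i, j)) (h (i, j))"
        using s by (simp add: states_def)
      from bspec[OF this, of "Suc k"] Suc.prems(1)
      show "fused_admissible r (h (Suc k, j + 1)) (v (k, j)) (v (Suc k, j)) (h (Suc k, j))" if "j < N" for j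
        using that by simp
    qed (simp_all add: boson_row_def)
    moreover have "h (Suc k, N) = Dolor (d a)" "h (Suc k, 0) = Color (inv w1 (Suc k))"
      using s Suc.prems(1) w2(2)[of "Suc k"] by (simp_all add: states_def a_def)
    ultimately have adm: "row_admissible (ps @ q # qs) (Dolor (d a)) (boson_row v k) (boson_row v (Suc k)) (Color (inv w1 (Suc k)))"
      by (simp add: pqs)
    \<comment> \<open>Each dolor belongs to exactly one boson on the top boundary, and that of
      \<open>d a\<close> sits at \<open>q\<close>.\<close>
    have ps: "boson_row v k q' = 0" if "q' \<in> set ps" "snd (snd q') = d a" for q'
    proof -
      have "q' \<noteq> q" using distinct_columns[of r N] that(1) by (auto simp: pqs)
      then have "rest k (fst q') (snd q') = 0"
        using that(2) d_inj by (intro rest_0) (auto simp: q_def)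
      then show ?thesis using IH[of q'] that(1) by (simp add: pqs)
    qed
    \<comment> \<open>A boson to the right of \<open>q\<close> has a smaller key than
      \<open>a\<close>, so an earlier row has absorbed it.\<close>
    have qs: "boson_row v k q' = 0" if "q' \<in> set qs" for q'
    proof -
      have less: "column_less q q'"
        using sorted_wrt_columns[of r N] that by (simp add: pqs sorted_wrt_append)
      have "rest k (fst q') (snd q') = 0"
      proof (rule rest_0, rule ccontr)
        fix i assume i: "i \<in> {1..r}" "q' = (lam i, (c i, d i))" "i \<notin> \<sigma> ` {1..k}"
        obtain m where m: "i = \<sigma> m" "m \<in> {1..r}"
          using i(1) permutes_image[OF \<sigma>(1)] by (metis imageE)
        with i(3) have "Suc k \<le> m" by (metis atLeastAtMost_iff image_eqI not_less_eq_eq)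
        then have le: "lam a * Suc r + d a \<le> lam i * Suc r + d i"
          using \<sigma>(2)[of "Suc k" m] m by (simp add: a_def)
        have "lam i * Suc r + d i < lam a * Suc r" if "lam i < lam a"
        proof -
          have "lam i * Suc r + Suc r \<le> lam a * Suc r"
            using that mult_le_mono1[of "Suc (lam i)" "lam a" "Suc r"] by simp
          then show ?thesis using ran(2)[OF i(1)] by simp
        qed
        then have "lam i = lam a" "d a = d i \<and> c a < c i"
          using less le by (auto simp: column_less_def q_def i(2) pair_less_def)
        then show False using d_inj[of a i] by auto
      qed
      then show ?thesis using IH[of q'] that by (simp add: pqs)
    qed
    have a_new: "a \<notin> \<sigma> ` {1..k}"
      using permutes_inj[OF \<sigma>(1)] by (auto simp: a_def inj_eq)
    have im: "\<sigma> ` {1..Suc k} = insert a (\<sigma> ` {1..k})"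
      by (simp add: atLeastAtMostSuc_conv a_def)
    have rest_q: "rest (Suc k) (fst q) (snd q) = rest k (fst q) (snd q) - 1"
    proof -
      have "{i\<in>{1..r}. lam i = fst q \<and> (c i, d i) = snd q \<and> i \<notin> \<sigma> ` {1..Suc k}} =
          {i\<in>{1..r}. lam i = fst q \<and> (c i, d i) = snd q \<and> i \<notin> \<sigma> ` {1..k}} - {a}"
        unfolding im by auto
      moreover have "a \<in> {i\<in>{1..r}. lam i = fst q \<and> (c i, d i) = snd q \<and> i \<notin> \<sigma> ` {1..k}}"
        using a a_new by (simp add: q_def)
      ultimately show ?thesis
        unfolding rest_def by (simp only: card_Diff_singleton)
    qed
    have rest_other: "rest (Suc k) (fst q') (snd q') = rest k (fst q') (snd q')" if "q' \<noteq> q" for q'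
    proof -
      have "{i\<in>{1..r}. lam i = fst q' \<and> (c i, d i) = snd q' \<and> i \<notin> \<sigma> ` {1..Suc k}} =
          {i\<in>{1..r}. lam i = fst q' \<and> (c i, d i) = snd q' \<and> i \<notin> \<sigma> ` {1..k}}"
        using that unfolding im by (auto simp: q_def prod_eq_iff)
      then show ?thesis by (simp only: rest_def)
    qed
    have q_eq: "snd q = (c a, d a)" by (simp add: q_def)
    note absorb = row_admissible_absorb_last[OF adm q_eq ps qs]
    have jp: "(j, p) \<in> set (columns r N)"
      using Suc.prems by (simp add: set_columns)
    have "boson_row v (Suc k) (j, p) = rest (Suc k) (fst (j, p)) (snd (j, p))"
    proof (cases "(j, p) = q")
      case True
      then show ?thesis using absorb(1) IH[OF jp] rest_q by simp
    next
      case False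
      then have "(j, p) \<in> set ps \<or> (j, p) \<in> set qs"
        using jp by (auto simp: pqs)
      then have "boson_row v (Suc k) (j, p) = boson_row v k (j, p)"
        using absorb(2,3) by blast
      then show ?thesis using IH[OF jp] rest_other[OF False] by simp
    qed
    then show ?case by (simp add: boson_row_def)
  qed
  show ?thesis
  proof (rule that[OF w2(1)])
    fix w1 s s' assume s: "s \<in> states r N lam w1 w2 w3 w4" "s' \<in> states r N lam w1 w2 w3 w4"
    obtain h v h' v' where hv: "s = (h, v)" "s' = (h', v')" by (metis surj_pair)
    show "s = s'"
      unfolding hv
    proof (rule states_eqI[OF s[unfolded hv]])
      show "v (i, j) p = v' (i, j) p" if "i \<le> r" "j < N" "p \<in> pairs r" for i j p
        using bosons[OF s(1)[unfolded hv(1)] that] bosons[OF s(2)[unfolded hv(2)] that] by simp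
    qed
  qed
qed

section \<open>Uniqueness\<close>

text \<open>Adjacent transpositions generate the symmetric group. The start is an arbitrary
  \<open>w0\<close>, reached from the identity by writing
  \<open>w = (w \<circ> inv w0) \<circ> w0\<close>.\<close>

lemma permutes_induct_simple_refl [consumes 2, case_names base simple_refl]:
  assumes w0: "w0 permutes {1..r}" and w: "w permutes {1..r}" and base: "P w0"
    and step: "\<And>i w. 1 \<le> i \<Longrightarrow> i < r \<Longrightarrow> w permutes {1..r} \<Longrightarrow> P w \<Longrightarrow> P (simple_refl i \<circ> w)"
  shows "P w"
proof -
  have lift: "w permutes {1..r} \<Longrightarrow> P w \<Longrightarrow> P (Transposition.transpose a (Suc (a + k)) \<circ> w)"
    if "1 \<le> a" "Suc (a + k) \<le> r" for a k w
    using that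
  proof (induction k arbitrary: w)
    case 0
    then show ?case using step[of a w] by (simp add: simple_refl_def comp_def)
  next
    case (Suc k)
    \<comment> \<open>Conjugating \<open>?\<tau>\<close> by the adjacent transposition
      \<open>?s\<close> moves its upper entry one step further.\<close>
    let ?s = "simple_refl (Suc (a + k))" and ?\<tau> = "Transposition.transpose a (Suc (a + k))"
    have s: "(?s \<circ> w) permutes {1..r}"
      by (rule simple_refl_comp_permutes) (use Suc.prems in auto)
    have P: "P (?s \<circ> w)"
      by (rule step) (use Suc.prems in auto)
    have \<tau>: "(?\<tau> \<circ> (?s \<circ> w)) permutes {1..r}"
      by (rule permutes_compose[OF s permutes_swap_id]) (use Suc.prems in auto)
    have "P (?\<tau> \<circ> (?s \<circ> w))"
      by (rule Suc.IH[OF s P]) (use Suc.prems in auto)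
    then have "P (?s \<circ> (?\<tau> \<circ> (?s \<circ> w)))"
      by (rule step[rotated 3]) (use Suc.prems \<tau> in auto)
    also have "?s \<circ> (?\<tau> \<circ> (?s \<circ> w)) = Transposition.transpose a (Suc (a + Suc k)) \<circ> w"
      by (auto simp: fun_eq_iff simple_refl_def Transposition.transpose_def)
    finally show ?case .
  qed
  have transp: "P (Transposition.transpose a b \<circ> w)"
    if ab: "a \<in> {1..r}" "b \<in> {1..r}" "a \<noteq> b" and "w permutes {1..r}" "P w" for a b w
  proof (cases a b rule: linorder_cases)
    case less
    then show ?thesis using lift[of a "b - Suc a" w] that by simp
  next
    case greater
    then show ?thesis using lift[of b "a - Suc b" w] that by (simp add: transpose_commute)
  qed (use ab in simp)
  have "P (u \<circ> w0)" if "u permutes {1..r}" for u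
    using that finite_atLeastAtMost
  proof (induction u rule: permutes_induct)
    case id
    then show ?case using base by simp
  next
    case (swap a b p)
    show ?case
      unfolding comp_assoc using swap.hyps(1-3) permutes_compose[OF w0 \<open>p permutes {1..r}\<close>] swap.IH
      by (rule transp)
  qed
  from this[OF permutes_compose[OF permutes_inv[OF w0] w]] show ?thesis
    using permutes_inv_o(2)[OF w0] by (simp add: comp_assoc)
qed

text \<open>Injective parameters stay injective under \<open>simple_refl i\<close>, so the induction
  hypothesis covers both terms of \<open>rec_rhs\<close> and the first term of
  \<open>rec_lhs\<close>.\<close>

lemma recurrence_determines_family:
  assumes t: "t \<noteq> 0" and F: "four_term_recurrence t r F" and G: "four_term_recurrence t r G"
    and w0: "w0 permutes {1..r}" and base: "\<And>w1 z. w1 permutes {1..r} \<Longrightarrow> z \<in> cspace r \<Longrightarrow> F w1 w0 z = G w1 w0 z"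
    and w2: "w2 permutes {1..r}" and w1: "w1 permutes {1..r}" and z: "z \<in> cspace r" "inj_on z {1..r}"
  shows "F w1 w2 z = G w1 w2 z"
  using w0 w2 w1 z
proof (induction w2 arbitrary: w1 z rule: permutes_induct_simple_refl)
  case base
  then show ?case by (intro assms)
next
  case (simple_refl i w)
  let ?s = "simple_refl i"
  note i = simple_refl.hyps(1,2)
  have s: "?s permutes {1..r}"
    using i by (rule simple_refl_permutes)
  have zs: "z \<circ> ?s \<in> cspace r"
    using simple_refl.prems(2) permutes_not_in[OF s] permutes_in_image[OF s]
    by (auto simp: cspace_def PiE_def extensional_def)
  have inj: "inj_on (z \<circ> ?s) {1..r}"
    using simple_refl.prems(3) permutes_inj_on[OF s] permutes_image[OF s] by (intro comp_inj_on) simp_all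
  have eq: "F u w z' = G u w z'" if "u permutes {1..r}" "z' \<in> cspace r" "inj_on z' {1..r}" for u z'
    using that by (rule simple_refl.IH)
  have "rec_rhs t r F i w1 w z = rec_rhs t r G i w1 w z"
    using eq[OF _ zs inj] simple_refl.prems(1) simple_refl_comp_permutes[OF simple_refl.prems(1) i]
    by (simp add: rec_rhs_def Let_def)
  moreover have "rec_lhs t r F i w1 w z = rec_rhs t r F i w1 w z" "rec_lhs t r G i w1 w z = rec_rhs t r G i w1 w z"
    using F G i simple_refl.prems simple_refl.hyps unfolding four_term_recurrence_def by blast+
  ultimately have "rec_lhs t r F i w1 w z = rec_lhs t r G i w1 w z"
    by simp
  \<comment> \<open>With \<open>t \<noteq> 0\<close> this makes the coefficient of the only unknown
    term nonzero in both Bruhat cases.\<close>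
  moreover have "z i \<noteq> z (i + 1)"
    using inj_onD[OF simple_refl.prems(3), of i "i + 1"] i by auto
  ultimately show ?case
    using t eq[OF simple_refl.prems] by (auto simp: rec_lhs_def comp_def split: if_splits)
qed

lemma partition_function_unique_generic:
  assumes t: "t \<noteq> 0" and F: "four_term_recurrence t r F" "correct_on_small_systems t r N lam w3 w4 F"
    and w: "w3 permutes {1..r}" "w4 permutes {1..r}" and lam: "\<And>i. i \<in> {1..r} \<Longrightarrow> lam i < N"
    and "w1 permutes {1..r}" "w2 permutes {1..r}" "z \<in> cspace r" "inj_on z {1..r}"
  shows "F w1 w2 z = partition_function t r N lam w3 w4 w1 w2 z"
proof -
  obtain w0 where w0: "w0 permutes {1..r}"
    "\<And>w1 s s'. s \<in> states r N lam w1 w0 w3 w4 \<Longrightarrow> s' \<in> states r N lam w1 w0 w3 w4 \<Longrightarrow> s = s'"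
    using ex_permutation_with_small_systems[where lam = lam, OF w lam] by blast
  have "F u w0 y = partition_function t r N lam w3 w4 u w0 y" if u: "u permutes {1..r}" and y: "y \<in> cspace r" for u y
  proof (cases "states r N lam u w0 w3 w4 = {}")
    case True
    then show ?thesis
      using F(2) u y w0(1) by (simp add: correct_on_small_systems_def partition_function_def)
  next
    case False
    then obtain s where "states r N lam u w0 w3 w4 = {s}"
      using w0(2) by blast
    then show ?thesis
      using F(2) u y w0(1) by (cases s) (simp add: correct_on_small_systems_def partition_function_def)
  qed
  then show ?thesis
    by (rule recurrence_determines_family[where F = F and G = "partition_function t r N lam w3 w4" and ?w0.0 = w0,
          OF t F(1) four_term_recurrence_partition_function w0(1) _ assms(8,7,9,10)])
qed

theorem theorem1p1:
  fixes r N :: nat and lam w3 w4 :: "nat \<Rightarrow> nat"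
  assumes "r \<ge> 1" and "N \<ge> 1"
    and "\<And>i j. 1 \<le> i \<Longrightarrow> i \<le> j \<Longrightarrow> j \<le> r \<Longrightarrow> lam j \<le> lam i" and "lam 1 < N"
    and "w3 permutes {1..r}" and "w4 permutes {1..r}"
  shows
    "(\<forall>t. four_term_recurrence t r (partition_function t r N lam w3 w4)) \<and>
     (\<forall>t F. t \<noteq> 0 \<and> four_term_recurrence t r F \<and> correct_on_small_systems t r N lam w3 w4 F \<longrightarrow>
        (\<forall>w1 w2. \<forall>z\<in>cspace r. w1 permutes {1..r} \<and> w2 permutes {1..r} \<and> inj_on z {1..r} \<longrightarrow>
           F w1 w2 z = partition_function t r N lam w3 w4 w1 w2 z) \<and>
        ((\<forall>w1 w2. w1 permutes {1..r} \<and> w2 permutes {1..r} \<longrightarrow>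
            continuous_on (cspace r) (F w1 w2)) \<longrightarrow>
         (\<forall>w1 w2. \<forall>z\<in>cspace r. w1 permutes {1..r} \<and> w2 permutes {1..r} \<longrightarrow>
            F w1 w2 z = partition_function t r N lam w3 w4 w1 w2 z))) \<and>
     (\<forall>F. (\<forall>t. four_term_recurrence t r (F t) \<and> correct_on_small_systems t r N lam w3 w4 (F t)) \<and>
        (\<forall>w1 w2. w1 permutes {1..r} \<and> w2 permutes {1..r} \<longrightarrow>
           continuous_on (UNIV \<times> cspace r) (\<lambda>(t, z). F t w1 w2 z)) \<longrightarrow>
        (\<forall>t w1 w2. \<forall>z\<in>cspace r. w1 permutes {1..r} \<and> w2 permutes {1..r} \<longrightarrow>
           F t w1 w2 z = partition_function t r N lam w3 w4 w1 w2 z))"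
proof -
  have lam: "lam i < N" if "i \<in> {1..r}" for i
    using assms(3)[of 1 i] assms(4) that by simp
  let ?Z = "partition_function"
  have cont: "continuous_on (cspace r) (?Z t r N lam w3 w4 w1 w2)" for t w1 w2
    by (intro continuous_on_partition_function continuous_intros continuous_on_coordinate_cspace)
  have cont': "continuous_on (UNIV \<times> cspace r) (\<lambda>(t, z). ?Z t r N lam w3 w4 w1 w2 z)" for w1 w2
    unfolding case_prod_unfold
    by (intro continuous_on_partition_function continuous_intros
        continuous_on_compose2[OF continuous_on_coordinate_cspace[of UNIV]]) simp
  have generic: "F w1 w2 z = ?Z t r N lam w3 w4 w1 w2 z"
    if "t \<noteq> 0" "four_term_recurrence t r F" "correct_on_small_systems t r N lam w3 w4 F"
      "w1 permutes {1..r}" "w2 permutes {1..r}" "z \<in> cspace r" "inj_on z {1..r}" for t F w1 w2 z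
    by (rule partition_function_unique_generic[where F = F]) (use that assms(5,6) lam in simp_all)
  have fixed_t: "F w1 w2 z = ?Z t r N lam w3 w4 w1 w2 z"
    if "t \<noteq> 0" "four_term_recurrence t r F" "correct_on_small_systems t r N lam w3 w4 F"
      "continuous_on (cspace r) (F w1 w2)" "w1 permutes {1..r}" "w2 permutes {1..r}" "z \<in> cspace r" for t F w1 w2 z
  proof (rule eq_on_cspace_if_eq_generic[OF that(4) cont that(7)])
    show "F w1 w2 y = ?Z t r N lam w3 w4 w1 w2 y" if "y \<in> cspace r" "inj_on y {1..r}" for y
      using \<open>t \<noteq> 0\<close> \<open>four_term_recurrence t r F\<close> \<open>correct_on_small_systems t r N lam w3 w4 F\<close>
        \<open>w1 permutes {1..r}\<close> \<open>w2 permutes {1..r}\<close> that by (rule generic)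
  qed
  have all_t: "F t w1 w2 z = ?Z t r N lam w3 w4 w1 w2 z"
    if "\<And>t. four_term_recurrence t r (F t)" "\<And>t. correct_on_small_systems t r N lam w3 w4 (F t)"
      "continuous_on (UNIV \<times> cspace r) (\<lambda>(t, z). F t w1 w2 z)"
      "w1 permutes {1..r}" "w2 permutes {1..r}" "z \<in> cspace r" for t F w1 w2 z
  proof -
    have "(\<lambda>(t, z). F t w1 w2 z) (t, z) = (\<lambda>(t, z). ?Z t r N lam w3 w4 w1 w2 z) (t, z)"
    proof (rule eq_if_eq_generic[OF that(3) cont' that(6)])
      show "(\<lambda>(t, z). F t w1 w2 z) (s, y) = (\<lambda>(t, z). ?Z t r N lam w3 w4 w1 w2 z) (s, y)"
        if "y \<in> cspace r" "s \<noteq> 0" "inj_on y {1..r}" for s y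
        using generic[OF that(2) \<open>\<And>t. four_term_recurrence t r (F t)\<close>
            \<open>\<And>t. correct_on_small_systems t r N lam w3 w4 (F t)\<close>
            \<open>w1 permutes {1..r}\<close> \<open>w2 permutes {1..r}\<close> that(1,3)] by simp
    qed
    then show ?thesis by simp
  qed
  show ?thesis
    by (intro conjI allI ballI impI; (elim conjE)?)
      (auto intro!: four_term_recurrence_partition_function intro: generic fixed_t all_t)
qed

end
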